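(* Let $\triangle^\ell_{\mathrm{PS}}$ be a Powell--Sabin refinement of $\triangle^\ell$ and let $B^2_\eta$, $\eta\in\Xi_2$, be the twice reduced edge/triangle functions over $\triangle^\ell_{\mathrm{PS}}$ defined in the context. Then every function $B^2_\eta$, $\eta\in\Xi_2$, has the following properties. (1) For each $t_k\in T^\ell$, the function is $C^2$ smooth at the split point $v_k^t$. (2) For each $t_k\in T^\ell$ and each edge $e_j$ of $t_k$, the function is $C^2$ smooth across the edge connecting $v_j^e$ and $v_k^t$. (3) For each $t_k\in T^\ell_{\mathrm{sym}}$, the function is $C^2$ smooth over the interior of the triangle $t_k$.
   Context: **Triangulation and split.** $\triangle$ is a (conforming) triangulation of a bounded planar polygonal domain $\Omega$. For $\ell\in\mathbb N$, $\ell\ge1$, $\triangle^\ell$ is the refinement of $\triangle$ obtained by splitting each triangle of $\triangle$ uniformly into $\ell^2$ congruent triangles so that each edge of $\triangle$ is split into $\ell$ equal intervals. $V^\ell,E^\ell,T^\ell$ are the sets of vertices $v_i$, edges $e_j$, triangles $t_k$ of $\triangle^\ell$. In each $t_k\in T^\ell$ a split point $v_k^t$ is chosen in the interior of $t_k$ such that for any two triangles $t_k,t_{k'}$ sharing an edge $e_j$ the segment $[v_k^t,v_{k'}^t]$ meets the interior of $e_j$; the intersection point is called $v_j^e$. If $e_j$ is a boundary edge, $v_j^e$ is its midpoint. The Powell--Sabin refinement $\triangle^\ell_{\mathrm{PS}}$ is obtained by connecting each $v_k^t$ to the three vertices of $t_k$ and to the three split points on the edges of $t_k$ (six small triangles per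 $t_k$, each of the form $\langle v_i,v_j^e,v_k^t\rangle$). **Symmetric triangles.** A triangle $t_k\in T^\ell$ with vertices $v_{i_1},v_{i_2},v_{i_3}$ has symmetric configuration if it has three neighbours in $\triangle^\ell$, these have vertices $\{v_{i_1},v_{i_2},v_{i_1}+v_{i_2}-v_{i_3}\}$, $\{v_{i_2},v_{i_3},v_{i_2}+v_{i_3}-v_{i_1}\}$, $\{v_{i_3},v_{i_1},v_{i_3}+v_{i_1}-v_{i_2}\}$, and the split points of $t_k$ and of its three neighbours are their barycenters. $T^\ell_{\mathrm{sym}}$ is the set of such triangles. **Cubic Powell--Sabin B-splines.** For each $v_i\in V^\ell$ a nondegenerate triangle $q_i^v$ is chosen that contains $v_i$ and all points $\frac23v_i+\frac13v_j^e$, $\frac23v_i+\frac13v_k^t$ for the edges $e_j$ and triangles $t_k$ of $\triangle^\ell$ attached to $v_i$. $\Xi_0$ is the set of triplets $(v_i,e_j,\tau)$, where $e_j\in E^\ell$, $v_i$ is an endpoint of $e_j$, and $\tau$ is a triangle of $T^\ell$ attached to $e_j$, or $\tau=\emptyset$ if $e_j$ is a boundary edge (so each edge gives four triplets). Given real coefficients $c_{i,r}$ ($v_i\in V^\ell$, $r=1,2,3$) and $c_\xi$ ($\xi\in\Xi_0$), define a continuous piecewise cubic $s$ on $\triangle^\ell_{\mathrm{PS}}$ through its Bernstein--Bézier ordinates on the small triangles; write $b(p_1,p_2,p_3)$ (symmetric in its arguments) for the ordinate at domain point $(p_1+p_2+p_3)/3$, where $p_1,p_2,p_3$ are (possibly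 repeated) vertices of a small triangle. - Let $L_i$ be the affine function taking value $c_{i,r}$ at the $r$-th vertex of $q_i^v$. Then $b(v_i,v_i,w)=L_i(\frac23v_i+\frac13w)$ for $w=v_i$, $w=v_j^e$, $w=v_k^t$, with $e_j,t_k$ attached to $v_i$. - For $e_j$ with endpoints $v_i,v_{i'}$ write $v_j^e=\lambda v_i+\lambda'v_{i'}$, $\lambda+\lambda'=1$. For $t_k$ attached to $e_j$: $b(v_i,v_j^e,v_k^t)=\lambda\, b(v_i,v_i,v_k^t)+\lambda' c_{(v_i,e_j,t_k)}$, and analogously $b(v_{i'},v_j^e,v_k^t)=\lambda' b(v_{i'},v_{i'},v_k^t)+\lambda c_{(v_{i'},e_j,t_k)}$. - If $e_j$ is shared by $t_k,t_{k'}$ and $v_j^e=\mu v_k^t+\mu'v_{k'}^t$, $\mu+\mu'=1$, then $b(v_i,v_j^e,v_j^e)=\mu\, b(v_i,v_j^e,v_k^t)+\mu' b(v_i,v_j^e,v_{k'}^t)$ (same for $v_{i'}$). If $e_j$ is a boundary edge, then $b(v_i,v_j^e,v_j^e)=\lambda\, b(v_i,v_i,v_j^e)+\lambda' c_{(v_i,e_j,\emptyset)}$ and $b(v_{i'},v_j^e,v_j^e)=\lambda' b(v_{i'},v_{i'},v_j^e)+\lambda c_{(v_{i'},e_j,\emptyset)}$. - $b(v_j^e,v_j^e,w)=\lambda\, b(v_i,v_j^e,w)+\lambda' b(v_{i'},v_j^e,w)$ for $w\in\{v_j^e,v_k^t\}$. - If $t_k$ has vertices $v_{i_1},v_{i_2},v_{i_3}$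 and $v_k^t=a_1v_{i_1}+a_2v_{i_2}+a_3v_{i_3}$, $a_1+a_2+a_3=1$, then $b(v_{i_1},v_k^t,v_k^t)=a_1b(v_{i_1},v_{i_1},v_k^t)+a_2c_{(v_{i_1},e_{12},t_k)}+a_3c_{(v_{i_1},e_{13},t_k)}$, where $e_{12},e_{13}$ are the edges $[v_{i_1},v_{i_2}]$, $[v_{i_1},v_{i_3}]$ (and analogously for $v_{i_2},v_{i_3}$); $b(v_j^e,v_k^t,v_k^t)=\lambda\, b(v_i,v_k^t,v_k^t)+\lambda' b(v_{i'},v_k^t,v_k^t)$; $b(v_k^t,v_k^t,v_k^t)=\sum_{n=1}^3a_n b(v_{i_n},v_k^t,v_k^t)$. The function $s$ with $c_{i,r}=1$ and all other coefficients $0$ is a vertex function; these are listed as $B_1,\dots,B_m$, $m=3|V^\ell|$. The function $s$ with $c_\xi=1$ and all other coefficients $0$ is denoted $B^0_\xi$, $\xi\in\Xi_0$. **First reduction.** $\Xi_1$ is the set of pairs $(e_j,\tau)$ with $e_j\in E^\ell$ and $\tau\in T^\ell$ attached to $e_j$, or $\tau=\emptyset$ if $e_j$ is a boundary edge. For an edge $e_j$ with endpoints $v_i,v_{i'}$ put $B^1_{(e_j,\tau)}=B^0_{(v_i,e_j,\tau)}+B^0_{(v_{i'},e_j,\tau)}$. **Second reduction.** $\Xi_2$ is the union of the set of pairs $(\emptyset,t_k)$, $t_k\in T^\ell_{\mathrm{sym}}$, and the set of pairs $(e_j,\tau)\in\Xi_1$ with $\tau\notin T^\ell_{\mathrm{sym}}$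 ($\tau=\emptyset$ allowed). Put: - for $t_k\in T^\ell_{\mathrm{sym}}$: $B^2_{(\emptyset,t_k)}=\sum_{e_j}\big(\frac23B^1_{(e_j,t_k)}+\frac13B^1_{(e_j,t_{k'})}\big)$, the sum over the three edges $e_j$ of $t_k$, where $t_{k'}$ is the other triangle attached to $e_j$; - for $(e_j,\tau)\in\Xi_2$ such that the other triangle $t_k$ attached to $e_j$ is in $T^\ell_{\mathrm{sym}}$: $B^2_{(e_j,\tau)}=\frac23B^1_{(e_j,\tau)}+\frac13B^1_{(e_j,t_k)}$; - for all other $(e_j,\tau)\in\Xi_2$: $B^2_{(e_j,\tau)}=B^1_{(e_j,\tau)}$. **Smoothness.** A piecewise polynomial is $C^2$ smooth at a point if all its polynomial pieces around that point have the same derivatives up to order 2 there; it is $C^2$ across an edge if the two polynomial pieces sharing the edge have the same derivatives up to order 2 along it. *)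

theory Defs
  imports "HOL-Analysis.Analysis"
begin

section \<open>Triangulations and their uniform refinement\<close>

text \<open>
  Triangles and edges are the closed point sets; the set of triangles alone determines a
  triangulation. Their vertices are recovered as extreme points, the edges of a triangle by the
  library relation \<open>edge_of\<close>.
\<close>

type_synonym pt = "real^2"

definition vertices :: "pt set \<Rightarrow> pt set" where
  "vertices S = {v. v extreme_point_of S}"

text \<open>The regularity condition \<open>interior (closure \<Omega>) = \<Omega>\<close> excludes slits and punctures.\<close>

definition polygonal_domain :: "pt set \<Rightarrow> bool" where
  "polygonal_domain \<Omega> \<longleftrightarrow>
     open \<Omega> \<and> connected \<Omega> \<and> \<Omega> \<noteq> {} \<and> interior (closure \<Omega>) = \<Omega> \<and>
     (\<exists>\<S>. finite \<S> \<and> (\<forall>s\<in>\<S>. \<exists>a b. s = closed_segment a b) \<and> frontier \<Omega> = \<Union>\<S>)"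

text \<open>Conformity is part of the library notion \<open>triangulation\<close>: simplices meet in common faces.\<close>

definition triangulation_of :: "pt set set \<Rightarrow> pt set \<Rightarrow> bool" where
  "triangulation_of \<T> \<Omega> \<longleftrightarrow>
     triangulation \<T> \<and> (\<forall>t\<in>\<T>. 2 simplex t) \<and> \<Union>\<T> = closure \<Omega>"

definition lattice_pt :: "nat \<Rightarrow> pt \<Rightarrow> pt \<Rightarrow> pt \<Rightarrow> nat \<Rightarrow> nat \<Rightarrow> pt" where
  "lattice_pt l a b c i j = a + (real i / real l) *\<^sub>R (b - a) + (real j / real l) *\<^sub>R (c - a)"

text \<open>
  For a triangle with vertices \<open>a, b, c\<close> the first set collects the subtriangles that are
  translates of the triangle scaled by \<open>1/l\<close>, the second one the reflected subtriangles. The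
  labelling of the vertices does not matter.
\<close>

definition uniform_refinement :: "nat \<Rightarrow> pt set set \<Rightarrow> pt set set" where
  "uniform_refinement l \<T> =
     {convex hull {lattice_pt l a b c i j, lattice_pt l a b c (i+1) j, lattice_pt l a b c i (j+1)}
        | a b c i j. convex hull {a, b, c} \<in> \<T> \<and> i + j + 1 \<le> l} \<union>
     {convex hull {lattice_pt l a b c (i+1) j, lattice_pt l a b c i (j+1),
                   lattice_pt l a b c (i+1) (j+1)}
        | a b c i j. convex hull {a, b, c} \<in> \<T> \<and> i + j + 2 \<le> l}"

definition vertex_set :: "pt set set \<Rightarrow> pt set" where
  "vertex_set \<T> = (\<Union>t\<in>\<T>. vertices t)"

definition edge_set :: "pt set set \<Rightarrow> pt set set" where
  "edge_set \<T> = {e. \<exists>t\<in>\<T>. e edge_of t}"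

definition boundary_edge :: "pt set set \<Rightarrow> pt set \<Rightarrow> bool" where
  "boundary_edge \<T> e \<longleftrightarrow> (\<exists>!t. t \<in> \<T> \<and> e edge_of t)"

text \<open>The triangle other than \<open>t\<close> attached to \<open>e\<close>; meaningful only if it exists.\<close>

definition other_triangle :: "pt set set \<Rightarrow> pt set \<Rightarrow> pt set \<Rightarrow> pt set" where
  "other_triangle \<T> e t = (THE t'. t' \<in> \<T> \<and> e edge_of t' \<and> t' \<noteq> t)"


section \<open>Powell--Sabin refinements\<close>

text \<open>
  \<open>triangles\<close> are the triangles of the refined triangulation, \<open>tsplit t\<close> and \<open>esplit e\<close> the split
  points of triangles and edges, and \<open>vtri v 1\<close>, \<open>vtri v 2\<close>, \<open>vtri v 3\<close> the vertices of the
  triangle chosen around the vertex \<open>v\<close>.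
\<close>

record ps_config =
  triangles :: "pt set set"
  tsplit :: "pt set \<Rightarrow> pt"
  esplit :: "pt set \<Rightarrow> pt"
  vtri :: "pt \<Rightarrow> nat \<Rightarrow> pt"

definition ps_split_points :: "ps_config \<Rightarrow> bool" where
  "ps_split_points D \<longleftrightarrow>
     (\<forall>t\<in>triangles D. tsplit D t \<in> interior t) \<and>
     (\<forall>e. \<forall>t\<in>triangles D. \<forall>t'\<in>triangles D. t \<noteq> t' \<and> e edge_of t \<and> e edge_of t' \<longrightarrow>
        esplit D e \<in> closed_segment (tsplit D t) (tsplit D t') \<inter> rel_interior e) \<and>
     (\<forall>a b. boundary_edge (triangles D) (closed_segment a b) \<longrightarrow>
        esplit D (closed_segment a b) = midpoint a b)"

definition ps_vertex_triangles :: "ps_config \<Rightarrow> bool" where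
  "ps_vertex_triangles D \<longleftrightarrow>
     (\<forall>v\<in>vertex_set (triangles D).
        \<not> collinear {vtri D v 1, vtri D v 2, vtri D v 3} \<and>
        {v} \<union> {(2/3) *\<^sub>R v + (1/3) *\<^sub>R esplit D e | e. e \<in> edge_set (triangles D) \<and> v \<in> vertices e}
            \<union> {(2/3) *\<^sub>R v + (1/3) *\<^sub>R tsplit D t | t. t \<in> triangles D \<and> v \<in> vertices t}
          \<subseteq> convex hull {vtri D v 1, vtri D v 2, vtri D v 3})"

text \<open>
  The triple \<open>(v, e, t)\<close> indexes the small triangle spanned by \<open>v\<close>, \<open>esplit D e\<close> and \<open>tsplit D t\<close>.
\<close>

definition ps_index :: "ps_config \<Rightarrow> (pt \<times> pt set \<times> pt set) set" where
  "ps_index D = {(v, e, t). t \<in> triangles D \<and> e edge_of t \<and> v \<in> vertices e}"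

definition ps_cell :: "ps_config \<Rightarrow> pt \<times> pt set \<times> pt set \<Rightarrow> pt set" where
  "ps_cell D = (\<lambda>(v, e, t). convex hull {v, esplit D e, tsplit D t})"

definition ps_cells :: "ps_config \<Rightarrow> pt set set" where
  "ps_cells D = ps_cell D ` ps_index D"

definition barycenter :: "pt set \<Rightarrow> pt" where
  "barycenter t = (1/3) *\<^sub>R (\<Sum>v\<in>vertices t. v)"

definition neighbours :: "pt set set \<Rightarrow> pt set \<Rightarrow> pt set set" where
  "neighbours \<T> t = {t'\<in>\<T>. t' \<noteq> t \<and> (\<exists>e. e edge_of t \<and> e edge_of t')}"

definition sym_triangles :: "ps_config \<Rightarrow> pt set set" where
  "sym_triangles D =
     {t\<in>triangles D.
        (\<exists>v1 v2 v3. t = convex hull {v1, v2, v3} \<and>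
           neighbours (triangles D) t =
             {convex hull {v1, v2, v1 + v2 - v3},
              convex hull {v2, v3, v2 + v3 - v1},
              convex hull {v3, v1, v3 + v1 - v2}}) \<and>
        (\<forall>t'\<in>insert t (neighbours (triangles D) t). tsplit D t' = barycenter t')}"


section \<open>Cubic Powell--Sabin splines\<close>

text \<open>
  \<open>bary S x p\<close> is the barycentric coordinate of \<open>x\<close> belonging to \<open>p\<close> with respect to the finite
  affinely independent set \<open>S\<close> (two points of a line or three points of the plane).
\<close>

definition bary :: "pt set \<Rightarrow> pt \<Rightarrow> pt \<Rightarrow> real" where
  "bary S x = (THE u. (\<forall>p. p \<notin> S \<longrightarrow> u p = 0) \<and> sum u S = 1 \<and> (\<Sum>p\<in>S. u p *\<^sub>R p) = x)"

text \<open>Coefficients: \<open>cv v r\<close> with \<open>r \<in> {1,2,3}\<close>, and \<open>c (v, e, \<tau>)\<close>, where \<open>\<tau> = {}\<close> for boundary edges.\<close>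

type_synonym vcoeffs = "pt \<Rightarrow> nat \<Rightarrow> real"
type_synonym ecoeffs = "pt \<times> pt set \<times> pt set \<Rightarrow> real"

definition vertex_affine :: "ps_config \<Rightarrow> vcoeffs \<Rightarrow> pt \<Rightarrow> pt \<Rightarrow> real" where
  "vertex_affine D cv v x =
     (\<Sum>r\<in>{1,2,3}. bary {vtri D v 1, vtri D v 2, vtri D v 3} x (vtri D v r) * cv v r)"

definition edge_coord :: "ps_config \<Rightarrow> pt set \<Rightarrow> pt \<Rightarrow> real" where
  "edge_coord D e = bary (vertices e) (esplit D e)"

definition tri_coord :: "ps_config \<Rightarrow> pt set \<Rightarrow> pt \<Rightarrow> real" where
  "tri_coord D t = bary (vertices t) (tsplit D t)"

text \<open>
  Ordinates on the small triangle \<open>(v, e, t)\<close>: a letter \<open>v\<close>, \<open>e\<close> or \<open>t\<close> in the name of an ordinate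
  stands for an argument \<open>v\<close>, \<open>esplit D e\<close> or \<open>tsplit D t\<close> of \<open>b\<close>. If \<open>e\<close> is an interior edge, the
  formula for \<open>b_vee\<close> is symmetric in the two triangles attached to \<open>e\<close>.
\<close>

definition b_vvv :: "ps_config \<Rightarrow> vcoeffs \<Rightarrow> pt \<Rightarrow> real" where
  "b_vvv D cv v = vertex_affine D cv v ((2/3) *\<^sub>R v + (1/3) *\<^sub>R v)"

definition b_vve :: "ps_config \<Rightarrow> vcoeffs \<Rightarrow> pt \<Rightarrow> pt set \<Rightarrow> real" where
  "b_vve D cv v e = vertex_affine D cv v ((2/3) *\<^sub>R v + (1/3) *\<^sub>R esplit D e)"

definition b_vvt :: "ps_config \<Rightarrow> vcoeffs \<Rightarrow> pt \<Rightarrow> pt set \<Rightarrow> real" where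
  "b_vvt D cv v t = vertex_affine D cv v ((2/3) *\<^sub>R v + (1/3) *\<^sub>R tsplit D t)"

definition b_vet :: "ps_config \<Rightarrow> vcoeffs \<Rightarrow> ecoeffs \<Rightarrow> pt \<Rightarrow> pt set \<Rightarrow> pt set \<Rightarrow> real" where
  "b_vet D cv c v e t =
     edge_coord D e v * b_vvt D cv v t +
     (\<Sum>v'\<in>vertices e - {v}. edge_coord D e v' * c (v, e, t))"

definition b_vee :: "ps_config \<Rightarrow> vcoeffs \<Rightarrow> ecoeffs \<Rightarrow> pt \<Rightarrow> pt set \<Rightarrow> pt set \<Rightarrow> real" where
  "b_vee D cv c v e t =
     (if boundary_edge (triangles D) e
      then edge_coord D e v * b_vve D cv v e +
           (\<Sum>v'\<in>vertices e - {v}. edge_coord D e v' * c (v, e, {}))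
      else let t' = other_triangle (triangles D) e t;
               \<mu> = bary {tsplit D t, tsplit D t'} (esplit D e)
           in \<mu> (tsplit D t) * b_vet D cv c v e t + \<mu> (tsplit D t') * b_vet D cv c v e t')"

definition b_eee :: "ps_config \<Rightarrow> vcoeffs \<Rightarrow> ecoeffs \<Rightarrow> pt set \<Rightarrow> pt set \<Rightarrow> real" where
  "b_eee D cv c e t = (\<Sum>v\<in>vertices e. edge_coord D e v * b_vee D cv c v e t)"

definition b_eet :: "ps_config \<Rightarrow> vcoeffs \<Rightarrow> ecoeffs \<Rightarrow> pt set \<Rightarrow> pt set \<Rightarrow> real" where
  "b_eet D cv c e t = (\<Sum>v\<in>vertices e. edge_coord D e v * b_vet D cv c v e t)"

text \<open>In \<open>b_vtt\<close>, \<open>w\<close> runs over the two other vertices of \<open>t\<close>.\<close>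

definition b_vtt :: "ps_config \<Rightarrow> vcoeffs \<Rightarrow> ecoeffs \<Rightarrow> pt \<Rightarrow> pt set \<Rightarrow> real" where
  "b_vtt D cv c v t =
     tri_coord D t v * b_vvt D cv v t +
     (\<Sum>w\<in>vertices t - {v}. tri_coord D t w * c (v, closed_segment v w, t))"

definition b_ett :: "ps_config \<Rightarrow> vcoeffs \<Rightarrow> ecoeffs \<Rightarrow> pt set \<Rightarrow> pt set \<Rightarrow> real" where
  "b_ett D cv c e t = (\<Sum>v\<in>vertices e. edge_coord D e v * b_vtt D cv c v t)"

definition b_ttt :: "ps_config \<Rightarrow> vcoeffs \<Rightarrow> ecoeffs \<Rightarrow> pt set \<Rightarrow> real" where
  "b_ttt D cv c t = (\<Sum>v\<in>vertices t. tri_coord D t v * b_vtt D cv c v t)"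

definition ps_piece ::
  "ps_config \<Rightarrow> vcoeffs \<Rightarrow> ecoeffs \<Rightarrow> pt \<times> pt set \<times> pt set \<Rightarrow> pt \<Rightarrow> real" where
  "ps_piece D cv c = (\<lambda>(v, e, t) x.
     let \<beta> = bary {v, esplit D e, tsplit D t} x;
         \<alpha>1 = \<beta> v; \<alpha>2 = \<beta> (esplit D e); \<alpha>3 = \<beta> (tsplit D t)
     in b_vvv D cv v * \<alpha>1 ^ 3 + b_eee D cv c e t * \<alpha>2 ^ 3 + b_ttt D cv c t * \<alpha>3 ^ 3
        + 3 * b_vve D cv v e * \<alpha>1\<^sup>2 * \<alpha>2 + 3 * b_vvt D cv v t * \<alpha>1\<^sup>2 * \<alpha>3
        + 3 * b_vee D cv c v e t * \<alpha>1 * \<alpha>2\<^sup>2 + 3 * b_vtt D cv c v t * \<alpha>1 * \<alpha>3\<^sup>2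
        + 3 * b_eet D cv c e t * \<alpha>2\<^sup>2 * \<alpha>3 + 3 * b_ett D cv c e t * \<alpha>2 * \<alpha>3\<^sup>2
        + 6 * b_vet D cv c v e t * \<alpha>1 * \<alpha>2 * \<alpha>3)"

text \<open>
  On common points of small triangles the pieces agree, so the choice of the piece is immaterial;
  outside the triangulated region the value is irrelevant and set to \<open>0\<close>.
\<close>

definition ps_spline :: "ps_config \<Rightarrow> vcoeffs \<Rightarrow> ecoeffs \<Rightarrow> pt \<Rightarrow> real" where
  "ps_spline D cv c x =
     (if x \<in> \<Union>(ps_cells D)
      then ps_piece D cv c (SOME k. k \<in> ps_index D \<and> x \<in> ps_cell D k) x
      else 0)"


section \<open>Edge and triangle functions and their reductions\<close>

text \<open>As in the index of the coefficients, \<open>\<emptyset>\<close> is rendered by the empty point set.\<close>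

definition Xi0 :: "ps_config \<Rightarrow> (pt \<times> pt set \<times> pt set) set" where
  "Xi0 D = {(v, e, \<tau>). e \<in> edge_set (triangles D) \<and> v \<in> vertices e \<and>
     (\<tau> \<in> triangles D \<and> e edge_of \<tau> \<or> \<tau> = {} \<and> boundary_edge (triangles D) e)}"

definition B0 :: "ps_config \<Rightarrow> pt \<times> pt set \<times> pt set \<Rightarrow> pt \<Rightarrow> real" where
  "B0 D \<xi> = ps_spline D (\<lambda>_ _. 0) (\<lambda>\<zeta>. if \<zeta> = \<xi> then 1 else 0)"

definition Xi1 :: "ps_config \<Rightarrow> (pt set \<times> pt set) set" where
  "Xi1 D = {(e, \<tau>). e \<in> edge_set (triangles D) \<and>
     (\<tau> \<in> triangles D \<and> e edge_of \<tau> \<or> \<tau> = {} \<and> boundary_edge (triangles D) e)}"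

definition B1 :: "ps_config \<Rightarrow> pt set \<times> pt set \<Rightarrow> pt \<Rightarrow> real" where
  "B1 D = (\<lambda>(e, \<tau>) x. \<Sum>v\<in>vertices e. B0 D (v, e, \<tau>) x)"

definition Xi2 :: "ps_config \<Rightarrow> (pt set \<times> pt set) set" where
  "Xi2 D = {({}, t) | t. t \<in> sym_triangles D} \<union>
           {(e, \<tau>). (e, \<tau>) \<in> Xi1 D \<and> \<tau> \<notin> sym_triangles D}"

definition B2 :: "ps_config \<Rightarrow> pt set \<times> pt set \<Rightarrow> pt \<Rightarrow> real" where
  "B2 D = (\<lambda>(e, \<tau>) x.
     if e = {} then
       (\<Sum>e' | e' edge_of \<tau>.
          2/3 * B1 D (e', \<tau>) x + 1/3 * B1 D (e', other_triangle (triangles D) e' \<tau>) x)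
     else if \<exists>t\<in>sym_triangles D. e edge_of t \<and> t \<noteq> \<tau> then
       2/3 * B1 D (e, \<tau>) x + 1/3 * B1 D (e, other_triangle (triangles D) e \<tau>) x
     else B1 D (e, \<tau>) x)"


section \<open>Smoothness of piecewise polynomials\<close>

definition same_derivs2 :: "(pt \<Rightarrow> real) \<Rightarrow> (pt \<Rightarrow> real) \<Rightarrow> pt \<Rightarrow> bool" where
  "same_derivs2 f g x \<longleftrightarrow>
     f x = g x \<and>
     frechet_derivative f (at x) = frechet_derivative g (at x) \<and>
     (\<forall>u. frechet_derivative (\<lambda>y. frechet_derivative f (at y) u) (at x) =
          frechet_derivative (\<lambda>y. frechet_derivative g (at y) u) (at x))"

text \<open>
  \<open>P S\<close> is the polynomial piece of \<open>f\<close> on the cell \<open>S\<close>; it is uniquely determined if \<open>S\<close> has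
  nonempty interior. Smoothness includes that \<open>f\<close> is a piecewise polynomial.
\<close>

definition polynomial_pieces :: "pt set set \<Rightarrow> (pt \<Rightarrow> real) \<Rightarrow> (pt set \<Rightarrow> pt \<Rightarrow> real) \<Rightarrow> bool" where
  "polynomial_pieces \<S> f P \<longleftrightarrow>
     (\<forall>S\<in>\<S>. real_polynomial_function (P S) \<and> (\<forall>x\<in>S. f x = P S x))"

definition C2_at :: "pt set set \<Rightarrow> (pt \<Rightarrow> real) \<Rightarrow> pt \<Rightarrow> bool" where
  "C2_at \<S> f x \<longleftrightarrow>
     (\<exists>P. polynomial_pieces \<S> f P \<and>
        (\<forall>S\<in>\<S>. \<forall>S'\<in>\<S>. x \<in> S \<and> x \<in> S' \<longrightarrow> same_derivs2 (P S) (P S') x))"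

definition C2_across :: "pt set set \<Rightarrow> (pt \<Rightarrow> real) \<Rightarrow> pt set \<Rightarrow> bool" where
  "C2_across \<S> f s \<longleftrightarrow>
     (\<exists>P. polynomial_pieces \<S> f P \<and>
        (\<forall>S\<in>\<S>. \<forall>S'\<in>\<S>. s edge_of S \<and> s edge_of S' \<longrightarrow> (\<forall>x\<in>s. same_derivs2 (P S) (P S') x)))"

end

theory Submission
  imports Defs
begin

text \<open>
  With vanishing vertex coefficients and an edge/triangle coefficient that does not depend on the
  endpoint, the ordinates of a cell that involve the split point of \<open>t\<close> are polar values of one
  quadratic form on \<open>t\<close>. Hence the six pieces on \<open>t\<close> have the same second order Taylor polynomial
  at the split point. Across the line from the edge split point to the triangle split point, two
  pieces differ by a multiple of the cube of an affine function vanishing on that line. In a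
  symmetric triangle the weights \<open>2/3\<close> and \<open>1/3\<close> of the second reduction make the same true for the
  lines from the vertices to the barycenter. A cube of an affine function has vanishing
  derivatives up to order 2 on its zero line. That the pieces define a function at all rests on
  the conformity of the uniform refinement.
\<close>

section \<open>Barycentric coordinates in the plane\<close>

text \<open>The value of the spline at a point comes from an arbitrarily chosen small triangle, and
  \<open>other_triangle\<close> presupposes that an edge carries at most two triangles. Both
  smoothness predicates ask for polynomial pieces on all cells at once, so agreement of pieces is
  needed over the whole mesh, and \<open>uniform_refinement\<close> does not provide the
  face-to-face contact by definition.

  The weights 2/3 and 1/3 come from one coefficient comparison. In a symmetric triangle, let g be
  the coefficient at an edge, g' the one on the other side of that edge, and m = (g + g') / 2 the
  mean of the two. Across the line from a vertex to the barycenter, all terms up to degree 2 in the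
  transversal coordinate agree, with one exception. That term agrees iff m - 3/2 g is the same at
  the two edges meeting in the vertex. Up to the factor -1/2 this number is 2 g - g'. The pair g =
  2/3, g' = 1/3 gives 1, the pair g = 1/3, g' = 2/3 gives 0, so every twice reduced function has the
  same value of 2 g - g' at the three edges of each symmetric triangle.\<close>

lemma bary_eqI:
  assumes "\<not> affine_dependent S" "finite S" "\<And>p. p \<notin> S \<Longrightarrow> u p = 0" "sum u S = 1"
    "(\<Sum>p\<in>S. u p *\<^sub>R p) = x"
  shows "bary S x = u"
  unfolding bary_def
proof (rule the_equality)
  show "(\<forall>p. p \<notin> S \<longrightarrow> u p = 0) \<and> sum u S = 1 \<and> (\<Sum>p\<in>S. u p *\<^sub>R p) = x"
    using assms by auto
next
  fix w assume w: "(\<forall>p. p \<notin> S \<longrightarrow> w p = 0) \<and> sum w S = 1 \<and> (\<Sum>p\<in>S. w p *\<^sub>R p) = x"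
  have "sum (\<lambda>p. w p - u p) S = 0" "(\<Sum>p\<in>S. (w p - u p) *\<^sub>R p) = 0"
    using w assms by (simp_all add: sum_subtractf scaleR_left_diff_distrib)
  then have "\<forall>p\<in>S. w p - u p = 0"
    using assms(1,2) affine_dependent_explicit_finite[of S] by blast
  then show "w = u"
    using w assms(3) by (metis eq_iff_diff_eq_0 ext)
qed

section \<open>Signed area and Cramer's rule\<close>

text \<open>Twice the signed area of a triangle. Its vanishing is collinearity, its quotients are
  barycentric coordinates, and its sign tells on which side of the line through \<open>a\<close> and
  \<open>b\<close> the point \<open>c\<close> lies.\<close>

definition cross2 :: "pt \<Rightarrow> pt \<Rightarrow> pt \<Rightarrow> real" where
  "cross2 a b c = (b$1 - a$1) * (c$2 - a$2) - (b$2 - a$2) * (c$1 - a$1)"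

lemma collinear_iff_cross2: "collinear {a, b, c} \<longleftrightarrow> cross2 a b c = 0"
proof (cases "a = c")
  case True
  then show ?thesis by (simp add: cross2_def insert_commute)
next
  case False
  have "(\<exists>u. b = u *\<^sub>R a + (1 - u) *\<^sub>R c) \<longleftrightarrow> cross2 a b c = 0"
  proof
    assume "\<exists>u. b = u *\<^sub>R a + (1 - u) *\<^sub>R c"
    then obtain u where "b = u *\<^sub>R a + (1 - u) *\<^sub>R c" ..
    then have "b$1 = u * a$1 + (1 - u) * c$1" "b$2 = u * a$2 + (1 - u) * c$2" by simp_all
    then show "cross2 a b c = 0" unfolding cross2_def by algebra
  next
    assume c0: "cross2 a b c = 0"
    show "\<exists>u. b = u *\<^sub>R a + (1 - u) *\<^sub>R c"
    proof (cases "a$1 = c$1")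
      case True
      then have ne: "a$2 \<noteq> c$2" using False by (auto simp: vec_eq_iff forall_2)
      have "b$1 = a$1" using c0 True ne by (simp add: cross2_def)
      moreover have "b$2 = u * a$2 + (1 - u) * c$2" if "u = (b$2 - c$2) / (a$2 - c$2)" for u
        using ne that by (simp add: divide_simps) (simp add: algebra_simps)
      ultimately show ?thesis using True
        by (intro exI[of _ "(b$2 - c$2) / (a$2 - c$2)"]) (simp add: vec_eq_iff forall_2 left_diff_distrib)
    next
      case ne: False
      define u where "u = (b$1 - c$1) / (a$1 - c$1)"
      have u: "u * (a$1 - c$1) = b$1 - c$1" using ne by (simp add: u_def)
      then have "b$2 * (a$1 - c$1) = (u * a$2 + (1 - u) * c$2) * (a$1 - c$1)"
        using c0 unfolding cross2_def by algebra
      then have "b$2 = u * a$2 + (1 - u) * c$2" using ne by simp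
      moreover have "b$1 = u * a$1 + (1 - u) * c$1" using u by (simp add: algebra_simps)
      ultimately show ?thesis by (auto simp: vec_eq_iff forall_2)
    qed
  qed
  then show ?thesis using False by (simp add: collinear_3_expand)
qed

lemma noncollinear_distinct:
  "\<not> collinear {a, b, c} \<Longrightarrow> a \<noteq> b \<and> b \<noteq> c \<and> a \<noteq> c \<and> \<not> affine_dependent {a, b, c}"
  by (auto simp: collinear_3_eq_affine_dependent)

lemma bary3_unique:
  fixes a b c :: pt
  assumes "\<not> collinear {a, b, c}" "\<alpha> + \<beta> + \<gamma> = 1" "x = \<alpha> *\<^sub>R a + \<beta> *\<^sub>R b + \<gamma> *\<^sub>R c"
  shows "bary {a, b, c} x a = \<alpha>" "bary {a, b, c} x b = \<beta>" "bary {a, b, c} x c = \<gamma>"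
    "p \<notin> {a, b, c} \<Longrightarrow> bary {a, b, c} x p = 0"
proof -
  note d = noncollinear_distinct[OF assms(1)]
  have "bary {a, b, c} x = (\<lambda>p. if p = a then \<alpha> else if p = b then \<beta> else if p = c then \<gamma> else 0)"
    using d assms by (intro bary_eqI) auto
  then show "bary {a, b, c} x a = \<alpha>" "bary {a, b, c} x b = \<beta>" "bary {a, b, c} x c = \<gamma>"
    "p \<notin> {a, b, c} \<Longrightarrow> bary {a, b, c} x p = 0"
    using d by auto
qed

text \<open>Cramer's rule: each coordinate is the signed area after replacing one vertex by
  \<open>x\<close>. This turns the definite description in \<open>bary\<close> into an explicit
  affine function of \<open>x\<close>.\<close>

lemma cross2_solve:
  fixes a b c :: pt
  assumes "cross2 a b c \<noteq> 0"
  shows "cross2 x b c / cross2 a b c + cross2 a x c / cross2 a b c + cross2 a b x / cross2 a b c = 1"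
    "x = (cross2 x b c / cross2 a b c) *\<^sub>R a + (cross2 a x c / cross2 a b c) *\<^sub>R b + (cross2 a b x / cross2 a b c) *\<^sub>R c"
proof -
  have 0: "cross2 x b c + cross2 a x c + cross2 a b x = cross2 a b c"
    by (simp add: cross2_def algebra_simps)
  show "cross2 x b c / cross2 a b c + cross2 a x c / cross2 a b c + cross2 a b x / cross2 a b c = 1"
    using assms by (simp add: add_divide_distrib[symmetric] 0)
  have "x $ i = (cross2 x b c * a$i + cross2 a x c * b$i + cross2 a b x * c$i) / cross2 a b c" for i
    using assms exhaust_2[of i] by (auto simp: eq_divide_eq) (auto simp: cross2_def algebra_simps)
  then show "x = (cross2 x b c / cross2 a b c) *\<^sub>R a + (cross2 a x c / cross2 a b c) *\<^sub>R b + (cross2 a b x / cross2 a b c) *\<^sub>R c"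
    by (simp add: vec_eq_iff add_divide_distrib)
qed

lemma bary3:
  assumes "\<not> collinear {a, b, c}"
  shows "bary {a, b, c} x a = cross2 x b c / cross2 a b c" "bary {a, b, c} x b = cross2 a x c / cross2 a b c"
    "bary {a, b, c} x c = cross2 a b x / cross2 a b c"
  using assms by (simp_all add: collinear_iff_cross2 bary3_unique[OF assms cross2_solve])

lemma bary3_sum:
  assumes "\<not> collinear {a, b, c}"
  shows "bary {a, b, c} x a + bary {a, b, c} x b + bary {a, b, c} x c = 1"
    "x = bary {a, b, c} x a *\<^sub>R a + bary {a, b, c} x b *\<^sub>R b + bary {a, b, c} x c *\<^sub>R c"
  unfolding bary3[OF assms]
  using assms cross2_solve[of a b c x] by (simp_all add: collinear_iff_cross2)

lemma bary_vertex:
  assumes "\<not> collinear {a, b, c}"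
  shows "bary {a, b, c} a a = 1" "bary {a, b, c} a b = 0" "bary {a, b, c} a c = 0"
    "bary {a, b, c} b a = 0" "bary {a, b, c} b b = 1" "bary {a, b, c} b c = 0"
    "bary {a, b, c} c a = 0" "bary {a, b, c} c b = 0" "bary {a, b, c} c c = 1"
  using bary3_unique[OF assms, of 1 0 0] bary3_unique[OF assms, of 0 1 0]
    bary3_unique[OF assms, of 0 0 1] by simp_all

lemma bary_off: "\<not> collinear {a, b, c} \<Longrightarrow> p \<notin> {a, b, c} \<Longrightarrow> bary {a, b, c} x p = 0"
  by (rule bary3_unique(4)[OF _ bary3_sum])

lemma cross2_affine:
  assumes "\<alpha> + \<beta> + \<gamma> = 1"
  shows "cross2 (\<alpha> *\<^sub>R x + \<beta> *\<^sub>R y + \<gamma> *\<^sub>R z) b c = \<alpha> * cross2 x b c + \<beta> * cross2 y b c + \<gamma> * cross2 z b c"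
    "cross2 a (\<alpha> *\<^sub>R x + \<beta> *\<^sub>R y + \<gamma> *\<^sub>R z) c = \<alpha> * cross2 a x c + \<beta> * cross2 a y c + \<gamma> * cross2 a z c"
    "cross2 a b (\<alpha> *\<^sub>R x + \<beta> *\<^sub>R y + \<gamma> *\<^sub>R z) = \<alpha> * cross2 a b x + \<beta> * cross2 a b y + \<gamma> * cross2 a b z"
proof -
  have \<gamma>: "\<gamma> = 1 - \<alpha> - \<beta>" using assms by simp
  show "cross2 (\<alpha> *\<^sub>R x + \<beta> *\<^sub>R y + \<gamma> *\<^sub>R z) b c = \<alpha> * cross2 x b c + \<beta> * cross2 y b c + \<gamma> * cross2 z b c"
    "cross2 a (\<alpha> *\<^sub>R x + \<beta> *\<^sub>R y + \<gamma> *\<^sub>R z) c = \<alpha> * cross2 a x c + \<beta> * cross2 a y c + \<gamma> * cross2 a z c"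
    "cross2 a b (\<alpha> *\<^sub>R x + \<beta> *\<^sub>R y + \<gamma> *\<^sub>R z) = \<alpha> * cross2 a b x + \<beta> * cross2 a b y + \<gamma> * cross2 a b z"
    by (simp_all add: cross2_def \<gamma> algebra_simps)
qed

lemma bary_affine3:
  assumes "\<not> collinear {a, b, c}" "\<alpha> + \<beta> + \<gamma> = 1"
  shows "bary {a, b, c} (\<alpha> *\<^sub>R x + \<beta> *\<^sub>R y + \<gamma> *\<^sub>R z) p =
    \<alpha> * bary {a, b, c} x p + \<beta> * bary {a, b, c} y p + \<gamma> * bary {a, b, c} z p"
proof -
  consider "p = a" | "p = b" | "p = c" | "p \<notin> {a, b, c}" by auto
  then show ?thesis
    by cases (simp_all add: bary3[OF assms(1)] bary_off[OF assms(1)] cross2_affine[OF assms(2)] add_divide_distrib)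
qed

lemma real_polynomial_cross2:
  "real_polynomial_function (\<lambda>x. cross2 x b c)" "real_polynomial_function (\<lambda>x. cross2 a x c)"
  "real_polynomial_function (\<lambda>x. cross2 a b x)"
proof -
  have "real_polynomial_function (\<lambda>x::pt. x $ i)" for i
    by (rule real_polynomial_function.intros(1)[OF bounded_linear_vec_nth])
  then show "real_polynomial_function (\<lambda>x. cross2 x b c)" "real_polynomial_function (\<lambda>x. cross2 a x c)"
  "real_polynomial_function (\<lambda>x. cross2 a b x)"
    unfolding cross2_def by (intro real_polynomial_function_diff real_polynomial_function.intros(4) real_polynomial_function.intros(2) | simp)+
qed

lemma real_polynomial_bary:
  assumes "\<not> collinear {a, b, c}"
  shows "real_polynomial_function (\<lambda>x. bary {a, b, c} x p)"
proof -
  consider "p = a" | "p = b" | "p = c" | "p \<notin> {a, b, c}" by auto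
  then show ?thesis
    by cases (simp_all add: bary3[OF assms] bary_off[OF assms] real_polynomial_cross2
       real_polynomial_function_divide real_polynomial_function.intros(2))
qed

section \<open>Triangles, their vertices and their edges\<close>

lemma hull3_iff:
  assumes "\<not> collinear {a, b, c}"
  shows "x \<in> convex hull {a, b, c} \<longleftrightarrow>
    bary {a, b, c} x a \<ge> 0 \<and> bary {a, b, c} x b \<ge> 0 \<and> bary {a, b, c} x c \<ge> 0"
proof
  assume "x \<in> convex hull {a, b, c}"
  then obtain u v w where "0 \<le> u" "0 \<le> v" "0 \<le> w" "u + v + w = 1" "x = u *\<^sub>R a + v *\<^sub>R b + w *\<^sub>R c"
    by (auto simp: convex_hull_3)
  then show "bary {a, b, c} x a \<ge> 0 \<and> bary {a, b, c} x b \<ge> 0 \<and> bary {a, b, c} x c \<ge> 0"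
    using bary3_unique[OF assms] by metis
next
  assume "bary {a, b, c} x a \<ge> 0 \<and> bary {a, b, c} x b \<ge> 0 \<and> bary {a, b, c} x c \<ge> 0"
  then show "x \<in> convex hull {a, b, c}"
    using bary3_sum[OF assms, of x] unfolding convex_hull_3 by blast
qed

lemma interior_hull3_iff:
  assumes "\<not> collinear {a, b, c}"
  shows "x \<in> interior (convex hull {a, b, c}) \<longleftrightarrow>
    bary {a, b, c} x a > 0 \<and> bary {a, b, c} x b > 0 \<and> bary {a, b, c} x c > 0"
proof -
  have "interior (convex hull {a, b, c}) =
     {v. \<exists>x y z. 0 < x \<and> 0 < y \<and> 0 < z \<and> x + y + z = 1 \<and> x *\<^sub>R a + y *\<^sub>R b + z *\<^sub>R c = v}"
    by (rule interior_convex_hull_3_minimal[OF assms]) simp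
  then have "x \<in> interior (convex hull {a, b, c}) \<longleftrightarrow>
     (\<exists>u v w. 0 < u \<and> 0 < v \<and> 0 < w \<and> u + v + w = 1 \<and> x = u *\<^sub>R a + v *\<^sub>R b + w *\<^sub>R c)"
    by auto
  then show ?thesis
    by (metis bary3_unique(1-3)[OF assms] bary3_sum[OF assms, of x])
qed

lemma simplex2_iff: "2 simplex t \<longleftrightarrow> (\<exists>a b c. \<not> collinear {a, b, c} \<and> t = convex hull {a, b, c})" for t :: "pt set"
proof
  assume "2 simplex t"
  then obtain C where C: "\<not> affine_dependent C" "int (card C) = 3" "t = convex hull C"
    by (auto simp: simplex_def)
  then have "card C = 3" by simp
  then obtain a b c where "C = {a, b, c}" "a \<noteq> b" "b \<noteq> c" "a \<noteq> c"
    by (auto simp: card_3_iff)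
  with C show "\<exists>a b c. \<not> collinear {a, b, c} \<and> t = convex hull {a, b, c}"
    by (auto simp: collinear_3_eq_affine_dependent)
next
  assume "\<exists>a b c. \<not> collinear {a, b, c} \<and> t = convex hull {a, b, c}"
  then obtain a b c where "\<not> collinear {a, b, c}" "t = convex hull {a, b, c}" by blast
  then show "2 simplex t"
    unfolding simplex_def using noncollinear_distinct[of a b c] by (intro exI[of _ "{a,b,c}"]) auto
qed

lemma simplex2_noncollinear:
  fixes a b c :: pt
  assumes "2 simplex (convex hull {a, b, c})"
  shows "\<not> collinear {a, b, c}"
proof
  assume "collinear {a, b, c}"
  then have "aff_dim {a, b, c} \<le> 1" by (simp add: collinear_aff_dim)
  moreover have "aff_dim (convex hull {a, b, c}) = 2" using assms by (rule aff_dim_simplex)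
  ultimately show False by (simp add: aff_dim_convex_hull)
qed

lemma vertices_triangle:
  "\<not> collinear {a, b, c} \<Longrightarrow> vertices (convex hull {a, b, c}) = {a, b, c}"
  using noncollinear_distinct[of a b c]
  by (auto simp: vertices_def extreme_point_of_convex_hull_affine_independent)

lemma vertices_segment: "vertices (closed_segment a b) = {a, b}"
  by (auto simp: vertices_def extreme_point_of_segment)

text \<open>The faces of a simplex are the hulls of subsets of its vertices, and such a hull has
  dimension 1 exactly for two vertices.\<close>

lemma edge_of_triangle:
  fixes a b c :: pt
  assumes "\<not> collinear {a, b, c}"
  shows "e edge_of convex hull {a, b, c} \<longleftrightarrow>
    e = closed_segment a b \<or> e = closed_segment b c \<or> e = closed_segment c a"
proof -
  note d = noncollinear_distinct[OF assms]
  have f: "e face_of convex hull {a, b, c} \<longleftrightarrow> (\<exists>C \<subseteq> {a, b, c}. e = convex hull C)"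
    using d by (intro face_of_convex_hull_affine_independent) auto
  have s: "closed_segment x y = convex hull {x, y}" for x y :: pt
    by (rule segment_convex_hull)
  have dim: "aff_dim (convex hull C) = int (card C) - 1" if "C \<subseteq> {a, b, c}" for C
    using that d affine_independent_subset[of "{a,b,c}" C]
    by (simp add: aff_dim_convex_hull aff_dim_affine_independent)
  show ?thesis
  proof
    assume "e edge_of convex hull {a, b, c}"
    then obtain C where C: "C \<subseteq> {a, b, c}" "e = convex hull C" "aff_dim e = 1"
      unfolding edge_of_def f by auto
    then have "card C = 2" using dim[OF C(1)] by simp
    then obtain x y where xy: "C = {x, y}" "x \<noteq> y" by (auto simp: card_2_iff)
    have e: "e = closed_segment x y" by (simp only: C(2) xy(1) s)
    have "x \<in> {a, b, c}" "y \<in> {a, b, c}" using C(1) by (simp_all add: xy)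
    then consider "x = a \<and> y = b \<or> x = b \<and> y = a" | "x = b \<and> y = c \<or> x = c \<and> y = b"
      | "x = c \<and> y = a \<or> x = a \<and> y = c"
      using xy(2) by blast
    then show "e = closed_segment a b \<or> e = closed_segment b c \<or> e = closed_segment c a"
      by cases (auto simp: e closed_segment_commute)
  next
    assume "e = closed_segment a b \<or> e = closed_segment b c \<or> e = closed_segment c a"
    then have "\<exists>C \<subseteq> {a, b, c}. card C = 2 \<and> e = convex hull C"
    proof (elim disjE)
      assume "e = closed_segment a b" then show ?thesis using d by (intro exI[of _ "{a,b}"]) (auto simp: s)
    next
      assume "e = closed_segment b c" then show ?thesis using d by (intro exI[of _ "{b,c}"]) (auto simp: s)
    next
      assume "e = closed_segment c a" then show ?thesis using d by (intro exI[of _ "{c,a}"]) (auto simp: s)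
    qed
    then obtain C where C: "C \<subseteq> {a, b, c}" "card C = 2" "e = convex hull C" by blast
    then have "aff_dim e = 1" using dim[OF C(1)] by simp
    with C show "e edge_of convex hull {a, b, c}"
      unfolding edge_of_def f by blast
  qed
qed


section \<open>Conformity of the uniform refinement\<close>

lemma bary_eq_supported:
  assumes "\<not> affine_dependent S" "finite S" "S0 \<subseteq> S" "\<And>p. p \<notin> S0 \<Longrightarrow> u p = 0" "sum u S0 = 1"
    "(\<Sum>p\<in>S0. u p *\<^sub>R p) = x"
  shows "bary S x = u"
proof (rule bary_eqI)
  show "sum u S = 1"
    using assms sum.mono_neutral_right[of S S0 u] by auto
  show "(\<Sum>p\<in>S. u p *\<^sub>R p) = x"
    using assms sum.mono_neutral_right[of S S0 "\<lambda>p. u p *\<^sub>R p"] by auto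
qed (use assms in auto)

text \<open>Coordinates with respect to \<open>S0\<close>, extended by zero, satisfy the
  characterization of the coordinates for both larger sets, so uniqueness identifies the two. This
  transfers coordinates from one triangle to a neighbour.\<close>

lemma bary_common_face:
  assumes S: "\<not> affine_dependent S" "finite S" "S0 \<subseteq> S" and S': "\<not> affine_dependent S'" "finite S'" "S0 \<subseteq> S'"
    and x: "x \<in> convex hull S0"
  shows "bary S x = bary S' x" "p \<notin> S0 \<Longrightarrow> bary S x p = 0"
proof -
  have "finite S0" using S finite_subset by blast
  then obtain w where "sum w S0 = 1" "(\<Sum>p\<in>S0. w p *\<^sub>R p) = x"
    using x by (auto simp: convex_hull_finite)
  moreover define u where "u p = (if p \<in> S0 then w p else 0)" for p
  ultimately have "sum u S0 = 1" "(\<Sum>p\<in>S0. u p *\<^sub>R p) = x" and u: "\<And>p. p \<notin> S0 \<Longrightarrow> u p = 0"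
    by (auto simp: u_def)
  then have "bary S x = u" "bary S' x = u"
    using bary_eq_supported[OF S] bary_eq_supported[OF S'] by blast+
  then show "bary S x = bary S' x" "p \<notin> S0 \<Longrightarrow> bary S x p = 0"
    using u by auto
qed

section \<open>Faces cut out by integer slabs\<close>

text \<open>If a combination with positive weights attains the lower bound \<open>m\<close>, both
  end points must attain it.\<close>

lemma level_face_of:
  assumes "convex t" "\<And>x. x \<in> t \<Longrightarrow> h x \<ge> m"
    and aff: "\<And>x y u. u \<in> {0..1} \<Longrightarrow> h ((1 - u) *\<^sub>R x + u *\<^sub>R y) = (1 - u) * h x + u * h y"
  shows "{x \<in> t. h x = m} face_of t"
  unfolding face_of_def
proof (intro conjI ballI impI)
  show "convex {x \<in> t. h x = m}"
    unfolding convex_alt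
  proof (intro ballI allI impI)
    fix x y u assume "x \<in> {x \<in> t. h x = m}" "y \<in> {x \<in> t. h x = m}" "0 \<le> u \<and> u \<le> (1::real)"
    then show "(1 - u) *\<^sub>R x + u *\<^sub>R y \<in> {x \<in> t. h x = m}"
      using assms(1) aff[of u x y] by (auto simp: convex_alt algebra_simps)
  qed
next
  fix a b x assume ab: "a \<in> t" "b \<in> t" and x: "x \<in> {x \<in> t. h x = m}" "x \<in> open_segment a b"
  then obtain u where u: "0 < u" "u < 1" "x = (1 - u) *\<^sub>R a + u *\<^sub>R b"
    by (auto simp: in_segment)
  have "(1 - u) * (h a - m) + u * (h b - m) = 0"
    using x u aff[of u a b] by (simp add: algebra_simps)
  moreover have "(1 - u) * (h a - m) \<ge> 0" "u * (h b - m) \<ge> 0"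
    using u assms(2) ab by auto
  ultimately have "(1 - u) * (h a - m) = 0" "u * (h b - m) = 0" by linarith+
  then show "a \<in> {x \<in> t. h x = m}" "b \<in> {x \<in> t. h x = m}" using u ab by auto
qed auto

text \<open>At most three integer slabs meet a set confined to one of them: its own, which contains
  it, and the two adjacent ones, which touch it where \<open>h\<close> is extremal. The empty set is
  a face as well.\<close>

lemma slab_face_of:
  assumes "convex t" and slab: "\<And>x. x \<in> t \<Longrightarrow> of_int m \<le> h x \<and> h x \<le> of_int m + (1::real)"
    and aff: "\<And>x y u. u \<in> {0..1} \<Longrightarrow> h ((1 - u) *\<^sub>R x + u *\<^sub>R y) = (1 - u) * h x + u * h y"
  shows "{x \<in> t. of_int n \<le> h x \<and> h x \<le> of_int n + 1} face_of t"
proof -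
  consider "n = m" | "n = m + 1" | "n = m - 1" | "n \<ge> m + 2" | "n \<le> m - 2" by linarith
  then show ?thesis
  proof cases
    case 1
    then have "{x \<in> t. of_int n \<le> h x \<and> h x \<le> of_int n + 1} = t" using slab by auto
    then show ?thesis using assms(1) by (simp add: face_of_refl)
  next
    case 2
    then have "{x \<in> t. of_int n \<le> h x \<and> h x \<le> of_int n + 1} = {x \<in> t. - h x = - of_int m - 1}"
      using slab by force
    also have "\<dots> face_of t"
      using slab aff by (intro level_face_of[OF assms(1)]) (auto simp: algebra_simps)
    finally show ?thesis .
  next
    case 3
    then have "{x \<in> t. of_int n \<le> h x \<and> h x \<le> of_int n + 1} = {x \<in> t. h x = of_int m}"
      using slab by force
    also have "\<dots> face_of t"
      using slab aff by (intro level_face_of[OF assms(1)]) auto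
    finally show ?thesis .
  next
    case 4
    then have "of_int n \<ge> of_int m + (2::real)" by linarith
    then have "{x \<in> t. of_int n \<le> h x \<and> h x \<le> of_int n + 1} = {}" using slab by force
    then show ?thesis by (metis empty_face_of)
  next
    case 5
    then have "of_int n \<le> of_int m - (2::real)" by linarith
    then have "{x \<in> t. of_int n \<le> h x \<and> h x \<le> of_int n + 1} = {}" using slab by force
    then show ?thesis by (metis empty_face_of)
  qed
qed

text \<open>The refined triangles are the alcoves of the coordinates scaled by \<open>l\<close>: each lies in one unit
  slab per coordinate, and equals the intersection of these slabs. Intersecting with the slabs
  of another alcove therefore cuts out a face.\<close>

lemma lattice_up:
  fixes a b c :: pt and i j l :: nat
  assumes nc: "\<not> collinear {a, b, c}" and l: "l \<ge> 1"
  defines "A \<equiv> lattice_pt l a b c i j" and "B \<equiv> lattice_pt l a b c (i+1) j"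
    and "C \<equiv> lattice_pt l a b c i (j+1)"
  shows "\<not> collinear {A, B, C}"
    "bary {A, B, C} x A = real l * bary {a, b, c} x a - (real l - real i - real j - 1)"
    "bary {A, B, C} x B = real l * bary {a, b, c} x b - real i"
    "bary {A, B, C} x C = real l * bary {a, b, c} x c - real j"
proof -
  have l0: "real l \<noteq> 0" using l by simp
  have "cross2 A B C = cross2 a b c / (real l * real l)"
    using l0 by (simp add: cross2_def A_def B_def C_def lattice_pt_def field_simps)
  then show nc': "\<not> collinear {A, B, C}"
    using nc l0 by (simp add: collinear_iff_cross2)
  define r s where "r = bary {a, b, c} x b" and "s = bary {a, b, c} x c"
  have q: "bary {a, b, c} x a = 1 - r - s" using bary3_sum(1)[OF nc, of x] by (simp add: r_def s_def)
  have x: "x = (1 - r - s) *\<^sub>R a + r *\<^sub>R b + s *\<^sub>R c"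
    using bary3_sum(2)[OF nc, of x] q by (simp add: r_def s_def)
  have "x = (real l * (1 - r - s) - (real l - real i - real j - 1)) *\<^sub>R A
      + (real l * r - real i) *\<^sub>R B + (real l * s - real j) *\<^sub>R C"
    using l0 by (simp add: x vec_eq_iff A_def B_def C_def lattice_pt_def field_simps)
  note bary3_unique[OF nc' _ this]
  then show "bary {A, B, C} x A = real l * bary {a, b, c} x a - (real l - real i - real j - 1)"
    "bary {A, B, C} x B = real l * bary {a, b, c} x b - real i"
    "bary {A, B, C} x C = real l * bary {a, b, c} x c - real j"
    by (simp_all add: q r_def[symmetric] s_def[symmetric] algebra_simps)
qed

text \<open>Reflection reverses the signs of the scaled coordinates: the sides lie on the upper
  walls of the slabs, where those of an upright subtriangle lie on the lower walls.\<close>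

lemma lattice_down:
  fixes a b c :: pt and i j l :: nat
  assumes nc: "\<not> collinear {a, b, c}" and l: "l \<ge> 1"
  defines "A \<equiv> lattice_pt l a b c (i+1) j" and "B \<equiv> lattice_pt l a b c i (j+1)"
    and "C \<equiv> lattice_pt l a b c (i+1) (j+1)"
  shows "\<not> collinear {A, B, C}"
    "bary {A, B, C} x A = real j + 1 - real l * bary {a, b, c} x c"
    "bary {A, B, C} x B = real i + 1 - real l * bary {a, b, c} x b"
    "bary {A, B, C} x C = real l - real i - real j - 1 - real l * bary {a, b, c} x a"
proof -
  have l0: "real l \<noteq> 0" using l by simp
  have "cross2 A B C = - cross2 a b c / (real l * real l)"
    using l0 by (simp add: cross2_def A_def B_def C_def lattice_pt_def field_simps)
  then show nc': "\<not> collinear {A, B, C}"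
    using nc l0 by (simp add: collinear_iff_cross2)
  define r s where "r = bary {a, b, c} x b" and "s = bary {a, b, c} x c"
  have q: "bary {a, b, c} x a = 1 - r - s" using bary3_sum(1)[OF nc, of x] by (simp add: r_def s_def)
  have x: "x = (1 - r - s) *\<^sub>R a + r *\<^sub>R b + s *\<^sub>R c"
    using bary3_sum(2)[OF nc, of x] q by (simp add: r_def s_def)
  have "x = (real j + 1 - real l * s) *\<^sub>R A + (real i + 1 - real l * r) *\<^sub>R B
      + (real l - real i - real j - 1 - real l * (1 - r - s)) *\<^sub>R C"
    using l0 by (simp add: x vec_eq_iff A_def B_def C_def lattice_pt_def field_simps)
  note bary3_unique[OF nc' _ this]
  then show "bary {A, B, C} x A = real j + 1 - real l * bary {a, b, c} x c"
    "bary {A, B, C} x B = real i + 1 - real l * bary {a, b, c} x b"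
    "bary {A, B, C} x C = real l - real i - real j - 1 - real l * bary {a, b, c} x a"
    by (simp_all add: q r_def[symmetric] s_def[symmetric] algebra_simps)
qed

lemma uniform_refinement_alcove:
  assumes "t \<in> uniform_refinement l \<T>" "\<And>T. T \<in> \<T> \<Longrightarrow> 2 simplex T" "l \<ge> 1"
  obtains a b c m where "convex hull {a, b, c} \<in> \<T>" "\<not> collinear {a, b, c}" "2 simplex t"
    "t \<subseteq> convex hull {a, b, c}"
    "t = {x. \<forall>p\<in>{a, b, c}. of_int (m p) \<le> real l * bary {a, b, c} x p \<and>
            real l * bary {a, b, c} x p \<le> of_int (m p) + 1}"
proof -
  consider (up) a b c i j where "convex hull {a, b, c} \<in> \<T>" "i + j + 1 \<le> l"
      "t = convex hull {lattice_pt l a b c i j, lattice_pt l a b c (i+1) j, lattice_pt l a b c i (j+1)}"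
    | (down) a b c i j where "convex hull {a, b, c} \<in> \<T>" "i + j + 2 \<le> l"
      "t = convex hull {lattice_pt l a b c (i+1) j, lattice_pt l a b c i (j+1), lattice_pt l a b c (i+1) (j+1)}"
    using assms(1) unfolding uniform_refinement_def by blast
  then show thesis
  proof cases
    case up
    have nc: "\<not> collinear {a, b, c}" using assms(2)[OF up(1)] by (rule simplex2_noncollinear)
    note d = noncollinear_distinct[OF nc]
    note L = lattice_up[OF nc assms(3)]
    \<comment> \<open>Lower walls of the slabs. The scaled coordinates sum to \<open>l\<close> and
      these integers to \<open>l - 1\<close>, so the three lower bounds, which describe the hull,
      force the upper ones.\<close>
    define m where "m p = (if p = a then int l - int i - int j - 1 else if p = b then int i else int j)" for p
    have teq: "t = {x. \<forall>p\<in>{a, b, c}. of_int (m p) \<le> real l * bary {a, b, c} x p \<and>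
            real l * bary {a, b, c} x p \<le> of_int (m p) + 1}"
      (is "t = ?R")
    proof (rule set_eqI)
      fix x
      have "real l * (bary {a, b, c} x a + bary {a, b, c} x b + bary {a, b, c} x c) = real l"
        by (simp add: bary3_sum(1)[OF nc])
      then show "x \<in> t \<longleftrightarrow> x \<in> ?R"
        using d unfolding up(3) hull3_iff[OF L(1)] L(2,3,4) by (auto simp: m_def distrib_left)
    qed
    have "t \<subseteq> convex hull {a, b, c}"
    proof
      fix x assume x: "x \<in> t"
      have "bary {a, b, c} x p \<ge> 0" if "p \<in> {a, b, c}" for p
      proof -
        have "(0::real) \<le> of_int (m p)" using up(2) by (auto simp: m_def)
        also have "\<dots> \<le> real l * bary {a, b, c} x p" using x that unfolding teq by blast
        finally show ?thesis using assms(3) by (simp add: zero_le_mult_iff)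
      qed
      then show "x \<in> convex hull {a, b, c}" unfolding hull3_iff[OF nc] by blast
    qed
    moreover have "2 simplex t" unfolding simplex2_iff up(3) using L(1) by blast
    ultimately show thesis using that up(1) nc teq by blast
  next
    case down
    have nc: "\<not> collinear {a, b, c}" using assms(2)[OF down(1)] by (rule simplex2_noncollinear)
    note d = noncollinear_distinct[OF nc]
    note L = lattice_down[OF nc assms(3)]
    \<comment> \<open>Here the integers sum to \<open>l - 2\<close>, so it is the three upper bounds
      that describe the hull and force the lower ones.\<close>
    define m where "m p = (if p = a then int l - int i - int j - 2 else if p = b then int i else int j)" for p
    have teq: "t = {x. \<forall>p\<in>{a, b, c}. of_int (m p) \<le> real l * bary {a, b, c} x p \<and>
            real l * bary {a, b, c} x p \<le> of_int (m p) + 1}"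
      (is "t = ?R")
    proof (rule set_eqI)
      fix x
      have "real l * (bary {a, b, c} x a + bary {a, b, c} x b + bary {a, b, c} x c) = real l"
        by (simp add: bary3_sum(1)[OF nc])
      then show "x \<in> t \<longleftrightarrow> x \<in> ?R"
        using d unfolding down(3) hull3_iff[OF L(1)] L(2,3,4) by (auto simp: m_def distrib_left)
    qed
    have "t \<subseteq> convex hull {a, b, c}"
    proof
      fix x assume x: "x \<in> t"
      have "bary {a, b, c} x p \<ge> 0" if "p \<in> {a, b, c}" for p
      proof -
        have "(0::real) \<le> of_int (m p)" using down(2) by (auto simp: m_def)
        also have "\<dots> \<le> real l * bary {a, b, c} x p" using x that unfolding teq by blast
        finally show ?thesis using assms(3) by (simp add: zero_le_mult_iff)
      qed
      then show "x \<in> convex hull {a, b, c}" unfolding hull3_iff[OF nc] by blast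
    qed
    moreover have "2 simplex t" unfolding simplex2_iff down(3) using L(1) by blast
    ultimately show thesis using that down(1) nc teq by blast
  qed
qed

text \<open>An affinely independent set is recovered from its hull as the set of extreme points, so
  both descriptions of the face use the same vertices.\<close>

lemma hull_face_subset:
  fixes S :: "pt set"
  assumes "\<not> affine_dependent S" "\<not> affine_dependent S'" "F face_of convex hull S" "F face_of convex hull S'"
  obtains S0 where "S0 \<subseteq> S" "S0 \<subseteq> S'" "F = convex hull S0"
proof -
  obtain S0 where S0: "S0 \<subseteq> S" "F = convex hull S0"
    using assms(1,3) face_of_convex_hull_affine_independent by blast
  obtain S1 where S1: "S1 \<subseteq> S'" "F = convex hull S1"
    using assms(2,4) face_of_convex_hull_affine_independent by blast
  have "\<not> affine_dependent S0" "\<not> affine_dependent S1"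
    using assms S0 S1 affine_independent_subset by blast+
  then have "x \<in> S0 \<longleftrightarrow> x \<in> S1" for x
    using extreme_point_of_convex_hull_affine_independent S0(2) S1(2) by metis
  then show thesis using that S0 S1 by blast
qed

text \<open>The coarse triangles meet in a common face \<open>F\<close>, on which their coordinates
  coincide. Hence each slab bounding \<open>t'\<close> cuts a face of \<open>t\<close> out of the
  part of \<open>t\<close> in \<open>F\<close>, and the intersection of \<open>t\<close> and
  \<open>t'\<close> is the intersection of these faces.\<close>

lemma uniform_refinement_conforming:
  assumes tr: "triangulation \<T>" and simp: "\<And>T. T \<in> \<T> \<Longrightarrow> 2 simplex T" and l: "l \<ge> 1"
    and t: "t \<in> uniform_refinement l \<T>" and t': "t' \<in> uniform_refinement l \<T>"
  shows "2 simplex t" "(t \<inter> t') face_of t"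
proof -
  obtain a b c m where T: "convex hull {a, b, c} \<in> \<T>" "\<not> collinear {a, b, c}" "2 simplex t"
    "t \<subseteq> convex hull {a, b, c}"
    and teq: "t = {x. \<forall>p\<in>{a, b, c}. of_int (m p) \<le> real l * bary {a, b, c} x p \<and>
            real l * bary {a, b, c} x p \<le> of_int (m p) + 1}"
    by (rule uniform_refinement_alcove[OF t simp l])
  obtain a' b' c' m' where T': "convex hull {a', b', c'} \<in> \<T>" "\<not> collinear {a', b', c'}"
    "2 simplex t'" "t' \<subseteq> convex hull {a', b', c'}"
    and teq': "t' = {x. \<forall>p\<in>{a', b', c'}. of_int (m' p) \<le> real l * bary {a', b', c'} x p \<and>
            real l * bary {a', b', c'} x p \<le> of_int (m' p) + 1}"
    by (rule uniform_refinement_alcove[OF t' simp l])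
  define W W' where "W = {a, b, c}" and "W' = {a', b', c'}"
  note T = T[folded W_def] and T' = T'[folded W'_def] and teq = teq[folded W_def] and teq' = teq'[folded W'_def]
  define F where "F = convex hull W \<inter> convex hull W'"
  show "2 simplex t" by fact
  then have "convex t" by (auto simp: simplex_def)
  have ind: "\<not> affine_dependent W" "\<not> affine_dependent W'" and fin: "finite W" "finite W'"
    using noncollinear_distinct T(2) T'(2) unfolding W_def W'_def by auto
  have F: "F face_of convex hull W" "F face_of convex hull W'"
    using tr T(1) T'(1) unfolding triangulation_def F_def by (blast, metis Int_commute)
  obtain W0 where W0: "W0 \<subseteq> W" "W0 \<subseteq> W'" "F = convex hull W0"
    using ind F by (rule hull_face_subset)
  have bary: "bary W x = bary W' x" "p \<notin> W0 \<Longrightarrow> bary W' x p = 0" if "x \<in> F" for x p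
    using that bary_common_face(1)[OF ind(1) fin(1) W0(1) ind(2) fin(2) W0(2), of x]
      bary_common_face(2)[OF ind(2) fin(2) W0(2) ind(1) fin(1) W0(1), of x p] W0(3) by auto
  have "convex hull W \<inter> t = t" using T(4) by blast
  then have tF: "(F \<inter> t) face_of t"
    using face_of_slice[OF F(1) \<open>convex t\<close>] by (simp only:)
  define G where "G p = {x \<in> F \<inter> t. of_int (m' p) \<le> real l * bary W' x p \<and>
            real l * bary W' x p \<le> of_int (m' p) + 1}" for p
  \<comment> \<open>At a vertex of the common face, the coordinate of \<open>W'\<close> is also one
    of \<open>W\<close>, for which \<open>t\<close> lies in one integer slab. Any other coordinate
    of \<open>W'\<close> vanishes on \<open>F\<close>, so its slab keeps all of \<open>F\<close> or
    nothing.\<close>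
  have "G p face_of t" if "p \<in> W'" for p
  proof (cases "p \<in> W0")
    case True
    then have p: "p \<in> W" using W0 by blast
    have "{x \<in> t. of_int (m' p) \<le> real l * bary W x p \<and> real l * bary W x p \<le> of_int (m' p) + 1} face_of t"
    proof (rule slab_face_of[OF \<open>convex t\<close>])
      show "of_int (m p) \<le> real l * bary W x p \<and> real l * bary W x p \<le> of_int (m p) + 1" if "x \<in> t" for x
        using that p unfolding teq by blast
      show "real l * bary W ((1 - u) *\<^sub>R x + u *\<^sub>R y) p = (1 - u) * (real l * bary W x p) + u * (real l * bary W y p)" for x y u
      proof -
        have "bary W ((1 - u) *\<^sub>R x + u *\<^sub>R y) p = (1 - u) * bary W x p + u * bary W y p"
          using bary_affine3[OF T(2)[unfolded W_def], folded W_def, of "1 - u" u 0 x y _ p] by simp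
        then show ?thesis by (simp only: distrib_left mult.left_commute)
      qed
    qed
    note face_of_Int[OF tF this]
    moreover have "G p = (F \<inter> t) \<inter> {x \<in> t. of_int (m' p) \<le> real l * bary W x p \<and> real l * bary W x p \<le> of_int (m' p) + 1}"
    proof (rule set_eqI)
      fix x
      show "x \<in> G p \<longleftrightarrow> x \<in> (F \<inter> t) \<inter> {x \<in> t. of_int (m' p) \<le> real l * bary W x p \<and> real l * bary W x p \<le> of_int (m' p) + 1}"
      proof (cases "x \<in> F")
        case True
        show ?thesis unfolding G_def mem_Collect_eq Int_iff[of x "F \<inter> t"] bary(1)[OF True] by blast
      next
        case False
        then show ?thesis unfolding G_def by blast
      qed
    qed
    ultimately show ?thesis by (simp only:)
  next
    case False
    then have "G p = F \<inter> t \<or> G p = {}"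
    proof (cases "of_int (m' p) \<le> (0::real) \<and> 0 \<le> of_int (m' p) + (1::real)")
      case True
      then have "x \<in> G p" if "x \<in> F \<inter> t" for x
        using that bary(2)[OF _ False, of x] unfolding G_def by simp
      then show ?thesis unfolding G_def by blast
    next
      case no: False
      have "x \<notin> G p" for x
      proof
        assume x: "x \<in> G p"
        then have "bary W' x p = 0" using bary(2)[OF _ False] unfolding G_def by blast
        with x no show False unfolding G_def by simp
      qed
      then show ?thesis by blast
    qed
    then show ?thesis
      by (elim disjE) (simp_all only: tF empty_face_of)
  qed
  then have "\<Inter> (G ` W') face_of t" by (intro face_of_Inter) (auto simp: W'_def)
  moreover have "t \<inter> t' = \<Inter> (G ` W')"
    using T(4) T'(4) unfolding G_def F_def teq' by (auto simp: W'_def)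
  ultimately show "(t \<inter> t') face_of t" by simp
qed


section \<open>Second order contact of polynomials\<close>

lemma real_polynomial_has_derivative:
  fixes f :: "'a::real_normed_vector \<Rightarrow> real"
  assumes "real_polynomial_function f"
  shows "\<exists>f'. (\<forall>x. (f has_derivative f' x) (at x)) \<and> (\<forall>u. real_polynomial_function (\<lambda>x. f' x u))"
  using assms
proof induction
  case (linear f)
  then show ?case
    by (intro exI[of _ "\<lambda>_. f"])
      (auto intro: bounded_linear_imp_has_derivative real_polynomial_function.intros(2))
next
  case (const c)
  then show ?case
    by (intro exI[of _ "\<lambda>_ _. 0"]) (auto intro: real_polynomial_function.intros(2))
next
  case (add f g)
  then obtain f' g' where "\<forall>x. (f has_derivative f' x) (at x)" "\<forall>u. real_polynomial_function (\<lambda>x. f' x u)"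
    "\<forall>x. (g has_derivative g' x) (at x)" "\<forall>u. real_polynomial_function (\<lambda>x. g' x u)"
    by blast
  then show ?case
    by (intro exI[of _ "\<lambda>x u. f' x u + g' x u"])
      (auto intro: has_derivative_add real_polynomial_function.intros(3))
next
  case (mult f g)
  then obtain f' g' where "\<forall>x. (f has_derivative f' x) (at x)" "\<forall>u. real_polynomial_function (\<lambda>x. f' x u)"
    "\<forall>x. (g has_derivative g' x) (at x)" "\<forall>u. real_polynomial_function (\<lambda>x. g' x u)"
    by blast
  then show ?case using mult.hyps
    by (intro exI[of _ "\<lambda>x u. f x * g' x u + f' x u * g x"])
      (auto intro!: has_derivative_mult real_polynomial_function.intros(3,4))
qed

text \<open>Vanishing to second order. The derivative \<open>h'\<close> is required at every point
  because \<open>same_derivs2\<close> differentiates \<open>frechet_derivative\<close> as a function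
  of the point.\<close>

definition flat2 :: "(pt \<Rightarrow> real) \<Rightarrow> pt \<Rightarrow> bool" where
  "flat2 h x \<longleftrightarrow> h x = 0 \<and>
     (\<exists>h'. (\<forall>y. (h has_derivative h' y) (at y)) \<and> h' x = (\<lambda>_. 0) \<and>
           (\<forall>u. ((\<lambda>y. h' y u) has_derivative (\<lambda>_. 0)) (at x)))"

lemma flat2_add:
  assumes "flat2 f x" "flat2 g x"
  shows "flat2 (\<lambda>y. f y + g y) x"
proof -
  obtain f' g' where
    "\<forall>y. (f has_derivative f' y) (at y)" "f' x = (\<lambda>_. 0)" "\<forall>u. ((\<lambda>y. f' y u) has_derivative (\<lambda>_. 0)) (at x)"
    "\<forall>y. (g has_derivative g' y) (at y)" "g' x = (\<lambda>_. 0)" "\<forall>u. ((\<lambda>y. g' y u) has_derivative (\<lambda>_. 0)) (at x)"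
    and "f x = 0" "g x = 0"
    using assms unfolding flat2_def by blast
  then show ?thesis
    unfolding flat2_def
    by (auto intro!: exI[of _ "\<lambda>y u. f' y u + g' y u"] has_derivative_add
        has_derivative_add[of _ "\<lambda>_. 0" _ _ "\<lambda>_. 0", simplified])
qed

text \<open>Two derivatives of a product of three factors leave one of them undifferentiated in
  every term. The factors may differ because the remainder at a split point contains mixed cubic
  monomials.\<close>

lemma flat2_product:
  assumes "real_polynomial_function l1" "real_polynomial_function l2" "real_polynomial_function l3"
    and 0: "l1 x = 0" "l2 x = 0" "l3 x = 0"
  shows "flat2 (\<lambda>y. k * (l1 y * l2 y * l3 y)) x"
proof -
  obtain d1 where d1: "\<And>y. (l1 has_derivative d1 y) (at y)" and p1: "\<And>u. real_polynomial_function (\<lambda>y. d1 y u)"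
    using real_polynomial_has_derivative[OF assms(1)] by blast
  obtain d2 where d2: "\<And>y. (l2 has_derivative d2 y) (at y)" and p2: "\<And>u. real_polynomial_function (\<lambda>y. d2 y u)"
    using real_polynomial_has_derivative[OF assms(2)] by blast
  obtain d3 where d3: "\<And>y. (l3 has_derivative d3 y) (at y)" and p3: "\<And>u. real_polynomial_function (\<lambda>y. d3 y u)"
    using real_polynomial_has_derivative[OF assms(3)] by blast
  define h' where "h' y u = k * (d1 y u * l2 y * l3 y + l1 y * d2 y u * l3 y + l1 y * l2 y * d3 y u)" for y u
  have "((\<lambda>y. k * (l1 y * l2 y * l3 y)) has_derivative h' y) (at y)" for y
    unfolding h'_def
    by (rule derivative_eq_intros d1 d2 d3 refl)+ (simp add: fun_eq_iff algebra_simps)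
  moreover have "((\<lambda>y. h' y u) has_derivative (\<lambda>_. 0)) (at x)" for u
  proof -
    obtain e1 where e1: "\<And>y. ((\<lambda>y. d1 y u) has_derivative e1 y) (at y)"
      using real_polynomial_has_derivative[OF p1] by blast
    obtain e2 where e2: "\<And>y. ((\<lambda>y. d2 y u) has_derivative e2 y) (at y)"
      using real_polynomial_has_derivative[OF p2] by blast
    obtain e3 where e3: "\<And>y. ((\<lambda>y. d3 y u) has_derivative e3 y) (at y)"
      using real_polynomial_has_derivative[OF p3] by blast
    show ?thesis
      unfolding h'_def
      by (rule derivative_eq_intros d1 d2 d3 e1 e2 e3 refl)+ (simp add: fun_eq_iff 0)
  qed
  ultimately show ?thesis
    unfolding flat2_def by (intro conjI exI[of _ h']) (auto simp: 0 h'_def)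
qed

lemma same_derivs2I:
  assumes g: "real_polynomial_function g" and h: "flat2 h x" and f: "\<And>y. f y = g y + h y"
  shows "same_derivs2 f g x"
proof -
  obtain g' where g': "\<And>y. (g has_derivative g' y) (at y)" and p: "\<And>u. real_polynomial_function (\<lambda>y. g' y u)"
    using real_polynomial_has_derivative[OF g] by blast
  obtain h' where h': "\<And>y. (h has_derivative h' y) (at y)" "h' x = (\<lambda>_. 0)"
    "\<And>u. ((\<lambda>y. h' y u) has_derivative (\<lambda>_. 0)) (at x)" and h0: "h x = 0"
    using h unfolding flat2_def by blast
  have "(f has_derivative (\<lambda>u. g' y u + h' y u)) (at y)" for y
    using has_derivative_add[OF g'[of y] h'(1)[of y]] f by presburger
  then have Df: "frechet_derivative f (at y) = (\<lambda>u. g' y u + h' y u)" for y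
    using frechet_derivative_at by metis
  have Dg: "frechet_derivative g (at y) = g' y" for y
    using frechet_derivative_at[OF g'] by simp
  have "frechet_derivative (\<lambda>y. g' y u + h' y u) (at x) = frechet_derivative (\<lambda>y. g' y u) (at x)" for u
  proof -
    obtain e where e: "\<And>y. ((\<lambda>y. g' y u) has_derivative e y) (at y)"
      using real_polynomial_has_derivative[OF p] by blast
    show ?thesis
      using frechet_derivative_at[OF e[of x]] frechet_derivative_at[OF has_derivative_add[OF e[of x] h'(3)[of u]]]
      by simp
  qed
  then show ?thesis
    unfolding same_derivs2_def Df Dg by (simp add: f h0 h'(2))
qed

lemma same_derivs2_sym: "same_derivs2 f g x \<Longrightarrow> same_derivs2 g f x"
  by (simp add: same_derivs2_def)

lemma same_derivs2_trans: "same_derivs2 f g x \<Longrightarrow> same_derivs2 g h x \<Longrightarrow> same_derivs2 f h x"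
  by (simp add: same_derivs2_def)

section \<open>Cubic identities in Bernstein form\<close>

text \<open>The Bernstein form on a small triangle when all ordinates b(v,v,w) vanish. The point has
  coordinates \<alpha>, \<beta>, \<gamma> at the vertex p, the edge split point and the triangle
  split point; \<theta>, \<theta>' locate the edge split point on [p,q], and \<open>a\<close>,
  \<open>b\<close>, \<open>c\<close> locate the triangle split point. The coefficient of each edge
  is \<open>gpq\<close>, \<open>gpr\<close>, \<open>gqr\<close>, and \<theta>' \<open>m\<close> is
  the ordinate b(p,e,e).\<close>

definition cell_poly :: "real \<Rightarrow> real \<Rightarrow> real \<Rightarrow> real \<Rightarrow> real \<Rightarrow> real \<Rightarrow> real \<Rightarrow> real \<Rightarrow> real \<Rightarrow> real \<Rightarrow> real \<Rightarrow> real \<Rightarrow> real" where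
  "cell_poly \<theta> \<theta>' m gpq gpr gqr a b c \<alpha> \<beta> \<gamma> =
     2 * \<theta> * \<theta>' * m * \<beta> ^ 3 + 2 * (a * b * gpq + a * c * gpr + b * c * gqr) * \<gamma> ^ 3
     + 3 * \<theta>' * m * \<alpha> * \<beta>\<^sup>2 + 3 * (b * gpq + c * gpr) * \<alpha> * \<gamma>\<^sup>2
     + 6 * \<theta> * \<theta>' * gpq * \<beta>\<^sup>2 * \<gamma>
     + 3 * (\<theta> * (b * gpq + c * gpr) + \<theta>' * (a * gpq + c * gqr)) * \<beta> * \<gamma>\<^sup>2
     + 6 * \<theta>' * gpq * \<alpha> * \<beta> * \<gamma>"

text \<open>If e = \<theta> p + \<theta>' q, then \<theta> s p = s e - \<theta>' s q, which explains
  the arguments on the left: the same point seen from the cell at q. Only terms with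
  \<open>m\<close> fail to match, and only in degree 3.\<close>

lemma cell_poly_across_edge_line:
  "cell_poly \<theta>' \<theta> m gpq gqr gpr b a c (- \<theta>' * s) (\<beta> + s) \<gamma> =
    cell_poly \<theta> \<theta>' m gpq gpr gqr a b c (\<theta> * s) \<beta> \<gamma> - \<theta> * \<theta>' * m * s ^ 3"
  unfolding cell_poly_def by (simp add: power2_eq_square power3_eq_cube algebra_simps)

text \<open>Both sides describe one point, seen from the two cells at the vertex q. Up to degree 2
  in \<beta>, only the coefficient of \<alpha> \<beta>^2 involves a mean, and it matches exactly
  when the mean minus 3/2 of the edge coefficient is the same for both edges; the common
  \<open>K\<close> expresses this.\<close>

lemma cell_poly_across_vertex_line:
  assumes "m1 = (3 * gqp - K) / 2" "m2 = (3 * gqr - K) / 2"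
  shows "cell_poly (1/2) (1/2) m2 gqr gqp gpr (1/3) (1/3) (1/3) (\<alpha> + \<beta> / 2) (- \<beta>) (\<gamma> + 3 / 2 * \<beta>) =
    cell_poly (1/2) (1/2) m1 gqp gqr gpr (1/3) (1/3) (1/3) \<alpha> \<beta> \<gamma>
    + (m2 / 4 - m1 / 2 + 3 / 4 * gqp - 3 / 8 * gqr - 3 / 8 * gpr) * \<beta> ^ 3"
  unfolding cell_poly_def assms by (simp add: power2_eq_square power3_eq_cube field_simps)

text \<open>Expansion at the split point T, where \<alpha> = \<beta> = 0; \<open>dp\<close>,
  \<open>dq\<close>, \<open>dr\<close> are the increments of the coordinates in the large triangle.
  The factors are those of a cubic with polar form f: f(T,T,T) + 3 f(d,T,T) + 3 f(d,d,T) + f(d,d,d),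
  where f(.,.,T) is the polar form of the quadratic form with coefficients 2 \<open>gpq\<close>, 2
  \<open>gpr\<close>, 2 \<open>gqr\<close>. The mean \<open>m\<close> enters the cubic remainder
  only.\<close>

lemma cell_poly_center:
  assumes "\<theta> + \<theta>' = 1" "a + b + c = 1" "\<alpha> + \<beta> + \<gamma> = 1"
    and "dp = \<alpha> * (1 - a) + \<beta> * (\<theta> - a)" "dq = - \<alpha> * b + \<beta> * (\<theta>' - b)" "dr = - (\<alpha> + \<beta>) * c"
    and "A = 2 * (a * b * gpq + a * c * gpr + b * c * gqr)"
    and "L1 = b * gpq + c * gpr" and "L2 = \<theta> * (b * gpq + c * gpr) + \<theta>' * (a * gpq + c * gqr)"
  shows "cell_poly \<theta> \<theta>' m gpq gpr gqr a b c \<alpha> \<beta> \<gamma> =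
     gpq * (2 * a * b + 3 * (a * dq + b * dp) + 6 * dp * dq)
     + gpr * (2 * a * c + 3 * (a * dr + c * dp) + 6 * dp * dr)
     + gqr * (2 * b * c + 3 * (b * dr + c * dq) + 6 * dq * dr)
     + ((- A + 3 * L1) * (\<alpha> * \<alpha> * \<alpha>)
       + (- 3 * A + 6 * L1 + 3 * L2 - 6 * \<theta>' * gpq) * (\<alpha> * \<alpha> * \<beta>)
       + (- 3 * A + 3 * L1 + 6 * L2 - 6 * \<theta>' * gpq - 6 * \<theta> * \<theta>' * gpq + 3 * \<theta>' * m) * (\<alpha> * \<beta> * \<beta>)
       + (- A + 3 * L2 - 6 * \<theta> * \<theta>' * gpq + 2 * \<theta> * \<theta>' * m) * (\<beta> * \<beta> * \<beta>))"
proof -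
  have e: "\<gamma> = 1 - \<alpha> - \<beta>" "\<theta>' = 1 - \<theta>" "c = 1 - a - b" using assms by simp_all
  show ?thesis
    unfolding cell_poly_def assms(4-) e
    by (simp add: power2_eq_square power3_eq_cube algebra_simps)
qed


section \<open>Geometry of Powell--Sabin cells\<close>

lemma bary2_unique:
  fixes p q :: pt
  assumes "p \<noteq> q" "u + v = 1" "x = u *\<^sub>R p + v *\<^sub>R q"
  shows "bary {p, q} x p = u" "bary {p, q} x q = v"
proof -
  have "bary {p, q} x = (\<lambda>y. if y = p then u else if y = q then v else 0)"
    using assms by (intro bary_eqI) (auto simp: affine_independent_2)
  then show "bary {p, q} x p = u" "bary {p, q} x q = v"
    using assms by auto
qed

lemma cross2_cell:
  assumes "l + l' = 1" "a + b + c = 1"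
  shows "cross2 p (l *\<^sub>R p + l' *\<^sub>R q) (a *\<^sub>R p + b *\<^sub>R q + c *\<^sub>R r) = l' * c * cross2 p q r"
proof -
  have e: "l = 1 - l'" "a = 1 - b - c" using assms by simp_all
  show ?thesis unfolding e by (simp add: cross2_def algebra_simps)
qed

text \<open>A point slightly off the midpoint of [p,q] towards \<open>r\<close> is interior to the
  first triangle and belongs to the second. A face that meets the interior is the whole
  triangle.\<close>

lemma same_side_triangles:
  fixes p q r r' :: pt
  assumes nc: "\<not> collinear {p, q, r}" and side: "cross2 p q r * cross2 p q r' > 0"
    and face: "(convex hull {p, q, r} \<inter> convex hull {p, q, r'}) face_of convex hull {p, q, r}"
  shows "convex hull {p, q, r} \<subseteq> convex hull {p, q, r'}"
proof -
  have nc': "\<not> collinear {p, q, r'}" using side by (auto simp: collinear_iff_cross2)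
  define y where "y w = bary {p, q, r'} r w" for w
  have yr: "y r' > 0"
    using side unfolding y_def bary3[OF nc'] by (simp add: zero_less_mult_iff zero_less_divide_iff)
  \<comment> \<open>With this size e |y p| is at most 1/2 - e, hence at most (1 - e) / 2, so the
    coordinates of \<open>z\<close> at \<open>p\<close> and \<open>q\<close> in the second triangle
    stay nonnegative.\<close>
  define e where "e = 1 / (2 * (1 + \<bar>y p\<bar> + \<bar>y q\<bar>))"
  have e: "0 < e" "e < 1" "e * (1 + \<bar>y p\<bar> + \<bar>y q\<bar>) = 1 / 2"
    by (auto simp: e_def add_pos_nonneg add_nonneg_pos field_simps add_nonneg_eq_0_iff)
  define z where "z = ((1 - e) / 2) *\<^sub>R p + ((1 - e) / 2) *\<^sub>R q + e *\<^sub>R r"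
  have s: "(1 - e) / 2 + (1 - e) / 2 + e = 1" by (simp add: field_simps)
  have "z \<in> interior (convex hull {p, q, r})"
    unfolding interior_hull3_iff[OF nc] bary3_unique(1-3)[OF nc s z_def] using e by simp
  moreover have "z \<in> convex hull {p, q, r'}"
  proof -
    have b: "bary {p, q, r'} z w = (1 - e) / 2 * bary {p, q, r'} p w + (1 - e) / 2 * bary {p, q, r'} q w + e * y w" for w
      unfolding z_def y_def by (rule bary_affine3[OF nc' s])
    have "e * y p \<ge> - (e * \<bar>y p\<bar>)" "e * y q \<ge> - (e * \<bar>y q\<bar>)" "e * \<bar>y p\<bar> \<ge> 0" "e * \<bar>y q\<bar> \<ge> 0" "e * y r' \<ge> 0"
      using e(1) yr by (auto simp: abs_if not_less mult_nonneg_nonpos intro: order_trans)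
    moreover have "e + e * \<bar>y p\<bar> + e * \<bar>y q\<bar> = 1 / 2" using e(3) by (simp add: distrib_left)
    moreover have "0 \<le> (1 - e) / 2 + A" if "- B \<le> A" "e + B + C = 1 / 2 \<or> e + C + B = 1 / 2" "0 \<le> C" for A B C
      using that e(1) by (elim disjE) (simp_all add: field_simps)
    ultimately have "0 \<le> (1 - e) / 2 + e * y p" "0 \<le> (1 - e) / 2 + e * y q" by blast+
    then show ?thesis using \<open>e * y r' \<ge> 0\<close>
      unfolding hull3_iff[OF nc'] b bary_vertex[OF nc'] by simp
  qed
  ultimately have "convex hull {p, q, r} \<inter> convex hull {p, q, r'} \<inter> interior (convex hull {p, q, r}) \<noteq> {}"
    using interior_subset by blast
  then have "convex hull {p, q, r} \<inter> convex hull {p, q, r'} = convex hull {p, q, r}"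
    using face_of_disjoint_interior[OF face] by blast
  then show ?thesis by blast
qed

text \<open>Conformity is kept as a face condition; it yields both the bound on the number of
  triangles at an edge and the agreement of pieces.\<close>

locale ps_mesh =
  fixes D :: ps_config
  assumes simplex: "t \<in> triangles D \<Longrightarrow> 2 simplex t"
    and conforming: "t \<in> triangles D \<Longrightarrow> t' \<in> triangles D \<Longrightarrow> (t \<inter> t') face_of t"
    and split_points: "ps_split_points D"
begin

section \<open>Labelled triangles and the two sides of an edge\<close>

text \<open>Orders the vertices so that \<open>p\<close> and \<open>e\<close> single out one small
  triangle of \<open>t\<close>. Swapping \<open>p\<close> and \<open>q\<close> passes to the other
  half of the edge, rotation to the next edge, so all six small triangles are covered.\<close>

definition labelled :: "pt \<Rightarrow> pt \<Rightarrow> pt \<Rightarrow> pt set \<Rightarrow> pt set \<Rightarrow> bool" where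
  "labelled p q r e t \<longleftrightarrow> t \<in> triangles D \<and> \<not> collinear {p, q, r} \<and> t = convex hull {p, q, r} \<and>
     e = closed_segment p q"

lemma labelledD:
  assumes "labelled p q r e t"
  shows "t \<in> triangles D" "\<not> collinear {p, q, r}" "t = convex hull {p, q, r}" "e = closed_segment p q"
    "p \<noteq> q" "q \<noteq> r" "p \<noteq> r" "vertices t = {p, q, r}" "vertices e = {p, q}" "e edge_of t"
  using assms noncollinear_distinct[of p q r] edge_of_triangle[of p q r e]
  by (auto simp: labelled_def vertices_triangle vertices_segment)

lemma labelled_swap: "labelled p q r e t \<Longrightarrow> labelled q p r e t"
  unfolding labelled_def by (auto simp: insert_commute closed_segment_commute)

lemma labelled_rot: "labelled p q r e t \<Longrightarrow> labelled q r p (closed_segment q r) t"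
  unfolding labelled_def by (auto simp: insert_commute)

lemma triangle_labelled:
  assumes "t \<in> triangles D"
  obtains p q r where "labelled p q r (closed_segment p q) t"
  using simplex[OF assms] assms unfolding simplex2_iff labelled_def by blast

lemma edge_labelled:
  assumes "t \<in> triangles D" "e edge_of t"
  obtains p q r where "labelled p q r e t"
proof -
  obtain a b c where abc: "labelled a b c (closed_segment a b) t" using triangle_labelled[OF assms(1)] .
  have "e = closed_segment a b \<or> e = closed_segment b c \<or> e = closed_segment c a"
    using assms(2) edge_of_triangle[OF labelledD(2)[OF abc]] labelledD(3)[OF abc] by blast
  then show thesis
    using that abc labelled_rot[OF abc] labelled_rot[OF labelled_rot[OF abc]] by blast
qed

lemma edge_labelled_from:
  assumes "t \<in> triangles D" "e edge_of t" "v \<in> vertices e"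
  obtains q r where "labelled v q r e t"
proof -
  obtain p q r where pq: "labelled p q r e t" using edge_labelled[OF assms(1,2)] .
  have "v = p \<or> v = q" using assms(3) labelledD(9)[OF pq] by auto
  then show thesis using that pq labelled_swap[OF pq] by blast
qed

lemma index_labelled: "(v, e, t) \<in> ps_index D \<longleftrightarrow> (\<exists>q r. labelled v q r e t)"
proof
  assume "(v, e, t) \<in> ps_index D"
  then show "\<exists>q r. labelled v q r e t"
    unfolding ps_index_def using edge_labelled_from by blast
next
  assume "\<exists>q r. labelled v q r e t"
  then obtain q r where "labelled v q r e t" by blast
  from labelledD[OF this] show "(v, e, t) \<in> ps_index D" by (simp add: ps_index_def)
qed

lemma shared_edge_labelled:
  assumes "labelled p q r e t" "t' \<in> triangles D" "e edge_of t'"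
  obtains r' where "labelled p q r' e t'"
proof -
  have "p \<in> vertices e" using labelledD[OF assms(1)] by simp
  then obtain q' r' where c: "labelled p q' r' e t'" using edge_labelled_from[OF assms(2,3)] by blast
  then have "q' = q" using labelledD(5,9)[OF c] labelledD(5,9)[OF assms(1)] by auto
  with c that show thesis by blast
qed

lemma same_side_eq:
  assumes "labelled p q r e t" "labelled p q r' e t'" "cross2 p q r * cross2 p q r' > 0"
  shows "t = t'"
proof
  note c = labelledD[OF assms(1)] and c' = labelledD[OF assms(2)]
  show "t \<subseteq> t'"
    using same_side_triangles[OF c(2) assms(3)] conforming[OF c(1) c'(1)] c(3) c'(3) by metis
  show "t' \<subseteq> t"
    using same_side_triangles[OF c'(2), of r] assms(3) conforming[OF c'(1) c(1)] c(3) c'(3)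
    by (metis mult.commute)
qed

text \<open>Of three signed areas over the same edge two have equal sign, and triangles on the same
  side of an edge coincide.\<close>

lemma at_most_two_triangles:
  assumes "t \<in> triangles D" "t' \<in> triangles D" "t'' \<in> triangles D"
    and "e edge_of t" "e edge_of t'" "e edge_of t''" and ne: "t \<noteq> t'" "t \<noteq> t''"
  shows "t' = t''"
proof -
  obtain p q r where c: "labelled p q r e t" using edge_labelled[OF assms(1,4)] .
  obtain r' where c': "labelled p q r' e t'" using shared_edge_labelled[OF c assms(2,5)] .
  obtain r'' where c'': "labelled p q r'' e t''" using shared_edge_labelled[OF c assms(3,6)] .
  have "cross2 p q r \<noteq> 0" "cross2 p q r' \<noteq> 0" "cross2 p q r'' \<noteq> 0"
    using labelledD(2)[OF c] labelledD(2)[OF c'] labelledD(2)[OF c''] by (auto simp: collinear_iff_cross2)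
  moreover have "\<not> cross2 p q r * cross2 p q r' > 0" "\<not> cross2 p q r * cross2 p q r'' > 0"
    using same_side_eq[OF c c'] same_side_eq[OF c c''] ne by blast+
  ultimately have "cross2 p q r' * cross2 p q r'' > 0"
    by (auto simp: zero_less_mult_iff not_less)
  then show ?thesis using same_side_eq[OF c' c''] by blast
qed

lemma other_triangle_eq:
  assumes "t \<in> triangles D" "t' \<in> triangles D" "e edge_of t" "e edge_of t'" "t \<noteq> t'"
  shows "other_triangle (triangles D) e t = t'" "\<not> boundary_edge (triangles D) e"
proof -
  show "other_triangle (triangles D) e t = t'"
    unfolding other_triangle_def
  proof (rule the_equality)
    show "t' \<in> triangles D \<and> e edge_of t' \<and> t' \<noteq> t" using assms by simp
    show "t'' = t'" if "t'' \<in> triangles D \<and> e edge_of t'' \<and> t'' \<noteq> t" for t''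
      using at_most_two_triangles[of t t'' t' e] assms that by fastforce
  qed
  show "\<not> boundary_edge (triangles D) e"
    unfolding boundary_edge_def using assms by blast
qed

lemma interior_edge:
  assumes "t \<in> triangles D" "e edge_of t" "\<not> boundary_edge (triangles D) e"
  obtains t' where "t' \<in> triangles D" "e edge_of t'" "t' \<noteq> t"
  using assms unfolding boundary_edge_def by blast

lemma tri_coord:
  assumes "labelled p q r e t"
  shows "0 < tri_coord D t p" "0 < tri_coord D t q" "0 < tri_coord D t r"
    "tri_coord D t p + tri_coord D t q + tri_coord D t r = 1"
    "tsplit D t = tri_coord D t p *\<^sub>R p + tri_coord D t q *\<^sub>R q + tri_coord D t r *\<^sub>R r"
proof -
  note c = labelledD[OF assms]
  have "tsplit D t \<in> interior t"
    using split_points c(1) by (simp add: ps_split_points_def)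
  then show "0 < tri_coord D t p" "0 < tri_coord D t q" "0 < tri_coord D t r"
    unfolding tri_coord_def c(8) using interior_hull3_iff[OF c(2)] c(3) by auto
  show "tri_coord D t p + tri_coord D t q + tri_coord D t r = 1"
    "tsplit D t = tri_coord D t p *\<^sub>R p + tri_coord D t q *\<^sub>R q + tri_coord D t r *\<^sub>R r"
    unfolding tri_coord_def c(8) by (rule bary3_sum[OF c(2)])+
qed

lemma edge_coord:
  assumes "labelled p q r e t"
  shows "0 < edge_coord D e p" "0 < edge_coord D e q" "edge_coord D e p + edge_coord D e q = 1"
    "esplit D e = edge_coord D e p *\<^sub>R p + edge_coord D e q *\<^sub>R q"
proof -
  note c = labelledD[OF assms]
  have "esplit D e \<in> open_segment p q"
  proof (cases "boundary_edge (triangles D) e")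
    case True
    then have "esplit D e = midpoint p q"
      using split_points c(4) by (auto simp: ps_split_points_def)
    then show ?thesis using c(5) by simp
  next
    case False
    then obtain t' where "t' \<in> triangles D" "e edge_of t'" "t' \<noteq> t"
      using interior_edge[OF c(1,10)] by blast
    then have "esplit D e \<in> rel_interior e"
      using split_points c(1,10) unfolding ps_split_points_def by blast
    then show ?thesis using c(4,5) by (simp add: rel_interior_closed_segment)
  qed
  then obtain u where u: "0 < u" "u < 1" "esplit D e = (1 - u) *\<^sub>R p + u *\<^sub>R q"
    by (auto simp: in_segment)
  have "edge_coord D e p = 1 - u" "edge_coord D e q = u"
    unfolding edge_coord_def c(9) using bary2_unique[OF c(5) _ u(3)] by simp_all
  then show "0 < edge_coord D e p" "0 < edge_coord D e q" "edge_coord D e p + edge_coord D e q = 1"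
    "esplit D e = edge_coord D e p *\<^sub>R p + edge_coord D e q *\<^sub>R q"
    using u by simp_all
qed

section \<open>Coordinates with respect to a small triangle\<close>

definition vcoord :: "pt \<Rightarrow> pt set \<Rightarrow> pt set \<Rightarrow> pt \<Rightarrow> real" where
  "vcoord v e t x = bary {v, esplit D e, tsplit D t} x v"

definition ecoord :: "pt \<Rightarrow> pt set \<Rightarrow> pt set \<Rightarrow> pt \<Rightarrow> real" where
  "ecoord v e t x = bary {v, esplit D e, tsplit D t} x (esplit D e)"

definition tcoord :: "pt \<Rightarrow> pt set \<Rightarrow> pt set \<Rightarrow> pt \<Rightarrow> real" where
  "tcoord v e t x = bary {v, esplit D e, tsplit D t} x (tsplit D t)"

lemma cell_noncollinear:
  assumes "labelled p q r e t"
  shows "\<not> collinear {p, esplit D e, tsplit D t}"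
proof -
  have "cross2 p (esplit D e) (tsplit D t) = edge_coord D e q * tri_coord D t r * cross2 p q r"
    unfolding edge_coord(4)[OF assms] tri_coord(5)[OF assms]
    by (rule cross2_cell[OF edge_coord(3)[OF assms] tri_coord(4)[OF assms]])
  then show ?thesis
    using labelledD(2)[OF assms] edge_coord(2)[OF assms] tri_coord(3)[OF assms] by (simp add: collinear_iff_cross2)
qed

lemma cell_sum:
  assumes "labelled p q r e t"
  shows "vcoord p e t x + ecoord p e t x + tcoord p e t x = 1"
    "x = vcoord p e t x *\<^sub>R p + ecoord p e t x *\<^sub>R esplit D e + tcoord p e t x *\<^sub>R tsplit D t"
  unfolding vcoord_def ecoord_def tcoord_def by (rule bary3_sum[OF cell_noncollinear[OF assms]])+

lemma cell_unique:
  assumes "labelled p q r e t" "\<alpha> + \<beta> + \<gamma> = 1" "x = \<alpha> *\<^sub>R p + \<beta> *\<^sub>R esplit D e + \<gamma> *\<^sub>R tsplit D t"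
  shows "vcoord p e t x = \<alpha>" "ecoord p e t x = \<beta>" "tcoord p e t x = \<gamma>"
  unfolding vcoord_def ecoord_def tcoord_def by (rule bary3_unique[OF cell_noncollinear[OF assms(1)] assms(2,3)])+

lemma cell_split:
  assumes "labelled p q r e t"
  shows "vcoord p e t (tsplit D t) = 0" "ecoord p e t (tsplit D t) = 0" "tcoord p e t (tsplit D t) = 1"
    "vcoord p e t (esplit D e) = 0" "ecoord p e t (esplit D e) = 1" "tcoord p e t (esplit D e) = 0"
  using cell_unique[OF assms, of 0 0 1 "tsplit D t"] cell_unique[OF assms, of 0 1 0 "esplit D e"] by simp_all

lemma cell_mem:
  assumes "labelled p q r e t"
  shows "x \<in> ps_cell D (p, e, t) \<longleftrightarrow> 0 \<le> vcoord p e t x \<and> 0 \<le> ecoord p e t x \<and> 0 \<le> tcoord p e t x"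
  unfolding vcoord_def ecoord_def tcoord_def ps_cell_def prod.case hull3_iff[OF cell_noncollinear[OF assms]] ..

lemma cell_poly_coords:
  assumes "labelled p q r e t"
  shows "real_polynomial_function (vcoord p e t)" "real_polynomial_function (ecoord p e t)"
    "real_polynomial_function (tcoord p e t)"
  unfolding vcoord_def[abs_def] ecoord_def[abs_def] tcoord_def[abs_def]
  by (rule real_polynomial_bary[OF cell_noncollinear[OF assms]])+

lemma cell_swap:
  assumes "labelled p q r e t"
  shows "vcoord q e t x = - edge_coord D e q * (vcoord p e t x / edge_coord D e p)"
    "ecoord q e t x = ecoord p e t x + vcoord p e t x / edge_coord D e p" "tcoord q e t x = tcoord p e t x"
proof -
  note E = edge_coord[OF assms]
  define s where "s = vcoord p e t x / edge_coord D e p"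
  have vcoord: "vcoord p e t x = edge_coord D e p * s" using E(1) by (simp add: s_def)
  have "x = (edge_coord D e p * s) *\<^sub>R p + ecoord p e t x *\<^sub>R esplit D e + tcoord p e t x *\<^sub>R tsplit D t"
    using cell_sum(2)[OF assms, of x] vcoord by simp
  also have "\<dots> = (- edge_coord D e q * s) *\<^sub>R q + (ecoord p e t x + s) *\<^sub>R esplit D e + tcoord p e t x *\<^sub>R tsplit D t"
    unfolding E(4) by (simp add: algebra_simps)
  finally have x: "x = (- edge_coord D e q * s) *\<^sub>R q + (ecoord p e t x + s) *\<^sub>R esplit D e + tcoord p e t x *\<^sub>R tsplit D t" .
  have "(edge_coord D e p + edge_coord D e q) * s = s" using E(3) by simp
  then have "- edge_coord D e q * s + (ecoord p e t x + s) + tcoord p e t x = 1"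
    using cell_sum(1)[OF assms, of x] vcoord by (simp add: algebra_simps)
  from cell_unique[OF labelled_swap[OF assms] this x]
  show "vcoord q e t x = - edge_coord D e q * (vcoord p e t x / edge_coord D e p)"
    "ecoord q e t x = ecoord p e t x + vcoord p e t x / edge_coord D e p" "tcoord q e t x = tcoord p e t x"
    by (simp_all add: s_def)
qed

lemma tau_cell:
  assumes "labelled p q r e t"
  shows "bary (vertices t) x p = vcoord p e t x + ecoord p e t x * edge_coord D e p + tcoord p e t x * tri_coord D t p"
    "bary (vertices t) x q = ecoord p e t x * edge_coord D e q + tcoord p e t x * tri_coord D t q"
    "bary (vertices t) x r = tcoord p e t x * tri_coord D t r"
proof -
  note c = labelledD[OF assms]
  have E: "bary {p, q, r} (esplit D e) p = edge_coord D e p" "bary {p, q, r} (esplit D e) q = edge_coord D e q"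
    "bary {p, q, r} (esplit D e) r = 0"
    using bary3_unique[OF c(2), of "edge_coord D e p" "edge_coord D e q" 0 "esplit D e"] edge_coord[OF assms]
    by simp_all
  have "bary {p, q, r} x w = vcoord p e t x * bary {p, q, r} p w + ecoord p e t x * bary {p, q, r} (esplit D e) w
      + tcoord p e t x * tri_coord D t w" for w
    using bary_affine3[OF c(2) cell_sum(1)[OF assms, of x], of p "esplit D e" "tsplit D t" w]
    unfolding cell_sum(2)[OF assms, of x, symmetric] tri_coord_def c(8) .
  then show "bary (vertices t) x p = vcoord p e t x + ecoord p e t x * edge_coord D e p + tcoord p e t x * tri_coord D t p"
    "bary (vertices t) x q = ecoord p e t x * edge_coord D e q + tcoord p e t x * tri_coord D t q"
    "bary (vertices t) x r = tcoord p e t x * tri_coord D t r"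
    unfolding c(8) by (simp_all add: E bary_vertex[OF c(2)])
qed

lemma cell_subset: "labelled p q r e t \<Longrightarrow> ps_cell D (p, e, t) \<subseteq> t"
proof
  fix x assume a: "labelled p q r e t" "x \<in> ps_cell D (p, e, t)"
  then have "0 \<le> vcoord p e t x" "0 \<le> ecoord p e t x" "0 \<le> tcoord p e t x" using cell_mem by blast+
  then have "bary (vertices t) x p \<ge> 0" "bary (vertices t) x q \<ge> 0" "bary (vertices t) x r \<ge> 0"
    unfolding tau_cell[OF a(1)] using edge_coord[OF a(1)] tri_coord[OF a(1)] by simp_all
  then show "x \<in> t"
    using hull3_iff[OF labelledD(2)[OF a(1)]] labelledD(3,8)[OF a(1)] by simp
qed

text \<open>The intersection is a face of \<open>t\<close> that meets its interior, hence all of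
  \<open>t\<close>. Thus \<open>t\<close> is a face of \<open>t'\<close>, and a proper face would
  have smaller dimension.\<close>

lemma interior_triangles_eq:
  assumes "t \<in> triangles D" "t' \<in> triangles D" "x \<in> interior t" "x \<in> t'"
  shows "t = t'"
proof -
  have "t \<inter> t' = t"
    using face_of_disjoint_interior[OF conforming[OF assms(1,2)]] assms(3,4) interior_subset by blast
  then have face: "t face_of t'"
    using conforming[OF assms(2,1)] by (simp add: Int_commute)
  have dim: "aff_dim t = 2" "aff_dim t' = 2" "convex t'"
    using simplex[OF assms(1)] simplex[OF assms(2)] by (simp_all add: aff_dim_simplex convex_simplex)
  show ?thesis
  proof (rule ccontr)
    assume "t \<noteq> t'"
    from face_of_aff_dim_lt[OF dim(3) face this] dim show False by simp
  qed
qed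

end


section \<open>Cubic pieces with vanishing vertex coefficients\<close>

text \<open>The first reduction adds the functions of both endpoints with equal weight, so a
  coefficient is a function \<open>g\<close> of the edge and the triangle.\<close>

locale ps_coeffs = ps_mesh +
  fixes c :: ecoeffs and g :: "pt set \<Rightarrow> pt set \<Rightarrow> real"
  assumes coeffs: "v \<in> vertices e \<Longrightarrow> c (v, e, \<tau>) = g e \<tau>"
begin

text \<open>The ordinate b(v,e,e) divided by the coordinate of the other endpoint. It is the same
  from both sides of the edge, which is what makes the pieces agree along it.\<close>

definition edge_mean :: "pt set \<Rightarrow> pt set \<Rightarrow> real" where
  "edge_mean e t =
     (if boundary_edge (triangles D) e then g e {}
      else let t' = other_triangle (triangles D) e t; \<mu> = bary {tsplit D t, tsplit D t'} (esplit D e)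
           in \<mu> (tsplit D t) * g e t + \<mu> (tsplit D t') * g e t')"

lemma edge_mean_shared:
  assumes "t \<in> triangles D" "t' \<in> triangles D" "e edge_of t" "e edge_of t'"
  shows "edge_mean e t = edge_mean e t'"
proof (cases "t = t'")
  case False
  note o = other_triangle_eq[OF assms False] other_triangle_eq[OF assms(2,1,4,3) False[symmetric]]
  show ?thesis by (simp add: edge_mean_def o Let_def insert_commute)
qed simp

abbreviation piece :: "pt \<times> pt set \<times> pt set \<Rightarrow> pt \<Rightarrow> real" where
  "piece \<equiv> ps_piece D (\<lambda>_ _. 0) c"

lemma vertex_affine_0: "vertex_affine D (\<lambda>_ _. 0) v x = 0"
  by (simp add: vertex_affine_def)

lemma vertex_ordinates_0:
  "b_vvv D (\<lambda>_ _. 0) v = 0" "b_vve D (\<lambda>_ _. 0) v e = 0" "b_vvt D (\<lambda>_ _. 0) v t = 0"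
  by (simp_all add: b_vvv_def b_vve_def b_vvt_def vertex_affine_0)

lemma b_vet_eq:
  assumes "labelled p q r e t"
  shows "b_vet D (\<lambda>_ _. 0) c p e t = edge_coord D e q * g e t"
proof -
  have "vertices e - {p} = {q}" using labelledD[OF assms] by auto
  then show ?thesis using labelledD(9)[OF assms] by (simp add: b_vet_def vertex_ordinates_0 coeffs)
qed

lemma b_vee_eq:
  assumes "labelled p q r e t"
  shows "b_vee D (\<lambda>_ _. 0) c p e t = edge_coord D e q * edge_mean e t"
proof (cases "boundary_edge (triangles D) e")
  case True
  have "vertices e - {p} = {q}" using labelledD[OF assms] by auto
  then show ?thesis using True labelledD(9)[OF assms]
    by (simp add: b_vee_def edge_mean_def vertex_ordinates_0 coeffs)
next
  case False
  note d = labelledD[OF assms]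
  obtain t' where t': "t' \<in> triangles D" "e edge_of t'" "t' \<noteq> t"
    using interior_edge[OF d(1,10) False] by blast
  then obtain r' where c': "labelled p q r' e t'" using shared_edge_labelled[OF assms] by blast
  have o: "other_triangle (triangles D) e t = t'"
    using other_triangle_eq(1)[OF d(1) t'(1) d(10) t'(2)] t'(3) by blast
  show ?thesis using False
    by (simp add: b_vee_def edge_mean_def Let_def o b_vet_eq[OF assms] b_vet_eq[OF c'] algebra_simps)
qed

lemma b_vtt_eq:
  assumes "labelled p q r e t"
  shows "b_vtt D (\<lambda>_ _. 0) c p t =
    tri_coord D t q * g (closed_segment p q) t + tri_coord D t r * g (closed_segment p r) t"
proof -
  have "vertices t - {p} = {q, r}" "q \<noteq> r" using labelledD[OF assms] by auto
  then show ?thesis by (simp add: b_vtt_def vertex_ordinates_0 coeffs vertices_segment)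
qed

lemma piece_eq:
  assumes "labelled p q r e t"
  shows "piece (p, e, t) x =
    cell_poly (edge_coord D e p) (edge_coord D e q) (edge_mean e t)
      (g (closed_segment p q) t) (g (closed_segment p r) t) (g (closed_segment q r) t)
      (tri_coord D t p) (tri_coord D t q) (tri_coord D t r) (vcoord p e t x) (ecoord p e t x) (tcoord p e t x)"
proof -
  note d = labelledD[OF assms]
  note sw = labelled_swap[OF assms]
  have cs: "closed_segment q p = closed_segment p q" "closed_segment r p = closed_segment p r"
    "closed_segment r q = closed_segment q r" by (simp_all add: closed_segment_commute)
  have vtt: "b_vtt D (\<lambda>_ _. 0) c p t = tri_coord D t q * g (closed_segment p q) t + tri_coord D t r * g (closed_segment p r) t"
    "b_vtt D (\<lambda>_ _. 0) c q t = tri_coord D t p * g (closed_segment p q) t + tri_coord D t r * g (closed_segment q r) t"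
    "b_vtt D (\<lambda>_ _. 0) c r t = tri_coord D t p * g (closed_segment p r) t + tri_coord D t q * g (closed_segment q r) t"
    using b_vtt_eq[OF assms] b_vtt_eq[OF sw] b_vtt_eq[OF labelled_rot[OF labelled_rot[OF assms]]] by (simp_all add: cs)
  have eee: "b_eee D (\<lambda>_ _. 0) c e t = 2 * edge_coord D e p * edge_coord D e q * edge_mean e t"
    using d(5) by (simp add: b_eee_def d(9) b_vee_eq[OF assms] b_vee_eq[OF sw])
  have eet: "b_eet D (\<lambda>_ _. 0) c e t = 2 * edge_coord D e p * edge_coord D e q * g e t"
    using d(5) by (simp add: b_eet_def d(9) b_vet_eq[OF assms] b_vet_eq[OF sw])
  have ett: "b_ett D (\<lambda>_ _. 0) c e t = edge_coord D e p * b_vtt D (\<lambda>_ _. 0) c p t + edge_coord D e q * b_vtt D (\<lambda>_ _. 0) c q t"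
    using d(5) by (simp add: b_ett_def d(9))
  have ttt: "b_ttt D (\<lambda>_ _. 0) c t = tri_coord D t p * b_vtt D (\<lambda>_ _. 0) c p t
      + tri_coord D t q * b_vtt D (\<lambda>_ _. 0) c q t + tri_coord D t r * b_vtt D (\<lambda>_ _. 0) c r t"
    using d(5-7) by (simp add: b_ttt_def d(8))
  show ?thesis
    unfolding ps_piece_def prod.case Let_def vertex_ordinates_0 eee eet ett ttt vtt
      b_vet_eq[OF assms] b_vee_eq[OF assms] d(4)[symmetric]
      cell_poly_def vcoord_def[symmetric] ecoord_def[symmetric] tcoord_def[symmetric]
    by (simp add: algebra_simps)
qed

lemma real_polynomial_piece:
  assumes "labelled p q r e t"
  shows "real_polynomial_function (piece (p, e, t))"
  unfolding piece_eq[OF assms, abs_def] cell_poly_def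
  by (intro real_polynomial_function.intros(2,3,4) real_polynomial_function_power cell_poly_coords[OF assms])

lemma piece_across_edge_line:
  assumes "labelled p q r e t"
  shows "piece (q, e, t) x = piece (p, e, t) x
    + (- edge_coord D e p * edge_coord D e q * edge_mean e t / edge_coord D e p ^ 3)
      * (vcoord p e t x * vcoord p e t x * vcoord p e t x)"
proof -
  note sw = labelled_swap[OF assms]
  have cs: "closed_segment q p = closed_segment p q" by (simp add: closed_segment_commute)
  have 1: "edge_coord D e p * (vcoord p e t x / edge_coord D e p) = vcoord p e t x"
    using edge_coord(1)[OF assms] by simp
  show ?thesis
    unfolding piece_eq[OF assms] piece_eq[OF sw] cell_swap[OF assms] cs cell_poly_across_edge_line 1
    by (simp add: power_divide power3_eq_cube)
qed

text \<open>The ordinates that involve the split point are polar values of the quadratic form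
  \<open>Q = \<Sum> g [v,w] t \<tau>\<^sub>v \<tau>\<^sub>w\<close>, so the second order Taylor polynomial of every piece at the split point is
  \<open>Q\<^sub>0 + 3/2 Q\<^sub>1 + 3 Q\<^sub>2\<close>, where \<open>Q\<^sub>i\<close> are the homogeneous parts of \<open>Q\<close> around that point.\<close>

definition center_poly :: "pt set \<Rightarrow> pt \<Rightarrow> real" where
  "center_poly t x =
     (\<Sum>v\<in>vertices t. \<Sum>w\<in>vertices t - {v}. g (closed_segment v w) t *
        (tri_coord D t v * tri_coord D t w
         + 3 * tri_coord D t v * (bary (vertices t) x w - tri_coord D t w)
         + 3 * (bary (vertices t) x v - tri_coord D t v) * (bary (vertices t) x w - tri_coord D t w)))"

lemma center_poly_eq:
  assumes "labelled p q r e t"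
  shows "center_poly t x =
    (let a = tri_coord D t p; b = tri_coord D t q; c = tri_coord D t r;
         dp = bary (vertices t) x p - a; dq = bary (vertices t) x q - b; dr = bary (vertices t) x r - c
     in g (closed_segment p q) t * (2 * a * b + 3 * (a * dq + b * dp) + 6 * dp * dq)
     + g (closed_segment p r) t * (2 * a * c + 3 * (a * dr + c * dp) + 6 * dp * dr)
     + g (closed_segment q r) t * (2 * b * c + 3 * (b * dr + c * dq) + 6 * dq * dr))"
proof -
  note d = labelledD[OF assms]
  have v: "vertices t - {p} = {q, r}" "vertices t - {q} = {p, r}" "vertices t - {r} = {p, q}"
    using d(5-8) by auto
  have cs: "closed_segment q p = closed_segment p q" "closed_segment r p = closed_segment p r"
    "closed_segment r q = closed_segment q r" by (simp_all add: closed_segment_commute)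
  have s3: "(\<Sum>v\<in>vertices t. f v) = f p + f q + f r" for f :: "pt \<Rightarrow> real"
    using d(5-7) by (simp add: d(8))
  have s2: "sum f {q, r} = f q + f r" "sum f {p, r} = f p + f r" "sum f {p, q} = f p + f q" for f :: "pt \<Rightarrow> real"
    using d(5-7) by simp_all
  show ?thesis
    unfolding center_poly_def s3 v s2 cs Let_def by (simp add: algebra_simps)
qed

lemma real_polynomial_center:
  assumes "labelled p q r e t"
  shows "real_polynomial_function (center_poly t)"
proof -
  have b: "real_polynomial_function (\<lambda>x. bary (vertices t) x w)" for w
    using real_polynomial_bary[OF labelledD(2)[OF assms]] labelledD(8)[OF assms] by simp
  show ?thesis
    unfolding center_poly_eq[OF assms, abs_def] Let_def
    by (intro real_polynomial_function.intros(2,3,4) real_polynomial_function_diff b)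
qed

lemma piece_center:
  assumes "labelled p q r e t"
  obtains h where "flat2 h (tsplit D t)" "\<And>x. piece (p, e, t) x = center_poly t x + h x"
proof -
  \<comment> \<open>These two coordinates vanish at the split point; the third is eliminated, so the
    remainder is a cubic form in \<open>f1\<close> and \<open>f2\<close>.\<close>
  define f1 f2 where "f1 = vcoord p e t" and "f2 = ecoord p e t"
  have poly: "real_polynomial_function f1" "real_polynomial_function f2"
    unfolding f1_def f2_def by (rule cell_poly_coords[OF assms])+
  have z: "f1 (tsplit D t) = 0" "f2 (tsplit D t) = 0"
    unfolding f1_def f2_def by (rule cell_split[OF assms])+
  define a b c where "a = tri_coord D t p" and "b = tri_coord D t q" and "c = tri_coord D t r"
  define \<theta> \<theta>' where "\<theta> = edge_coord D e p" and "\<theta>' = edge_coord D e q"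
  define gpq gpr gqr where "gpq = g (closed_segment p q) t" and "gpr = g (closed_segment p r) t"
    and "gqr = g (closed_segment q r) t"
  define m where "m = edge_mean e t"
  define A where "A = 2 * (a * b * gpq + a * c * gpr + b * c * gqr)"
  define L1 where "L1 = b * gpq + c * gpr"
  define L2 where "L2 = \<theta> * (b * gpq + c * gpr) + \<theta>' * (a * gpq + c * gqr)"
  define k1 k2 where "k1 = - A + 3 * L1" and "k2 = - 3 * A + 6 * L1 + 3 * L2 - 6 * \<theta>' * gpq"
  define k3 where "k3 = - 3 * A + 3 * L1 + 6 * L2 - 6 * \<theta>' * gpq - 6 * \<theta> * \<theta>' * gpq + 3 * \<theta>' * m"
  define k4 where "k4 = - A + 3 * L2 - 6 * \<theta> * \<theta>' * gpq + 2 * \<theta> * \<theta>' * m"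
  have abc: "a + b + c = 1" unfolding a_def b_def c_def by (rule tri_coord(4)[OF assms])
  have \<theta>: "\<theta> + \<theta>' = 1" unfolding \<theta>_def \<theta>'_def by (rule edge_coord(3)[OF assms])
  have k: "piece (p, e, t) x = center_poly t x
     + (k1 * (f1 x * f1 x * f1 x) + k2 * (f1 x * f1 x * f2 x) + k3 * (f1 x * f2 x * f2 x) + k4 * (f2 x * f2 x * f2 x))" for x
  proof -
    have s: "f1 x + f2 x + tcoord p e t x = 1" unfolding f1_def f2_def by (rule cell_sum(1)[OF assms])
    have 3: "tcoord p e t x = 1 - f1 x - f2 x" using s by simp
    note T = tau_cell[OF assms, of x, folded a_def b_def c_def \<theta>_def \<theta>'_def f1_def f2_def, unfolded 3]
    have d: "bary (vertices t) x p - a = f1 x * (1 - a) + f2 x * (\<theta> - a)"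
      "bary (vertices t) x q - b = - f1 x * b + f2 x * (\<theta>' - b)"
      "bary (vertices t) x r - c = - (f1 x + f2 x) * c"
      unfolding T by (simp_all add: algebra_simps)
    show ?thesis
      unfolding piece_eq[OF assms] center_poly_eq[OF assms] Let_def k1_def k2_def k3_def k4_def
        a_def[symmetric] b_def[symmetric] c_def[symmetric] \<theta>_def[symmetric] \<theta>'_def[symmetric]
        gpq_def[symmetric] gpr_def[symmetric] gqr_def[symmetric] m_def[symmetric]
        fun_cong[OF f1_def, symmetric] fun_cong[OF f2_def, symmetric]
      by (rule cell_poly_center[OF \<theta> abc s d A_def L1_def L2_def])
  qed
  show thesis
  proof (rule that)
    show "flat2 (\<lambda>x. k1 * (f1 x * f1 x * f1 x) + k2 * (f1 x * f1 x * f2 x) + k3 * (f1 x * f2 x * f2 x) + k4 * (f2 x * f2 x * f2 x)) (tsplit D t)"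
      by (intro flat2_add flat2_product poly z)
  qed (rule k)
qed

lemma same_derivs2_center:
  assumes "labelled p q r e t" "labelled p' q' r' e' t"
  shows "same_derivs2 (piece (p, e, t)) (piece (p', e', t)) (tsplit D t)"
proof -
  have *: "same_derivs2 (piece (p, e, t)) (center_poly t) (tsplit D t)" if a: "labelled p q r e t" for p q r e
  proof -
    obtain h where "flat2 h (tsplit D t)" "\<And>x. piece (p, e, t) x = center_poly t x + h x"
      using piece_center[OF a] by blast
    then show ?thesis using same_derivs2I[OF real_polynomial_center[OF a]] by blast
  qed
  show ?thesis using same_derivs2_trans[OF *[OF assms(1)] same_derivs2_sym[OF *[OF assms(2)]]] .
qed

lemma same_derivs2_across_edge_line:
  assumes "labelled p q r e t" "vcoord p e t x = 0"
  shows "same_derivs2 (piece (q, e, t)) (piece (p, e, t)) x"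
proof (rule same_derivs2I[OF real_polynomial_piece[OF assms(1)]])
  show "flat2 (\<lambda>x. (- edge_coord D e p * edge_coord D e q * edge_mean e t / edge_coord D e p ^ 3)
      * (vcoord p e t x * vcoord p e t x * vcoord p e t x)) x"
    by (intro flat2_product cell_poly_coords[OF assms(1)] assms(2))
qed (rule piece_across_edge_line[OF assms(1)])

end


section \<open>Agreement of pieces and smoothness\<close>

context ps_mesh
begin

section \<open>Common points of two small triangles\<close>

lemma cells_edge_line:
  assumes "labelled p q r e t" "x \<in> ps_cell D (p, e, t)" "x \<in> ps_cell D (q, e, t)"
  shows "vcoord p e t x = 0"
proof -
  note E = edge_coord[OF assms(1)]
  have "0 \<le> vcoord p e t x" "0 \<le> vcoord q e t x"
    using assms(2,3) cell_mem[OF assms(1)] cell_mem[OF labelled_swap[OF assms(1)]] by blast+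
  moreover have "vcoord q e t x = - (edge_coord D e q / edge_coord D e p) * vcoord p e t x"
    using cell_swap(1)[OF assms(1), of x] by simp
  moreover have "edge_coord D e q / edge_coord D e p > 0" using E by simp
  ultimately show ?thesis
    by (metis mult_minus_left neg_0_le_iff_le mult_pos_pos not_le order_antisym_conv)
qed

text \<open>The line through \<open>q\<close> and the split point is the zero set of the affine function
  \<open>a\<^sub>r \<tau>\<^sub>p - a\<^sub>p \<tau>\<^sub>r\<close>, which has a sign on every cell attached to an edge at \<open>q\<close>.\<close>

lemma cell_vertex_line_side:
  assumes "labelled p q r e t" "v = p \<or> v = q" "x \<in> ps_cell D (v, e, t)"
  defines "\<phi> \<equiv> tri_coord D t r * bary (vertices t) x p - tri_coord D t p * bary (vertices t) x r"
  shows "\<phi> \<ge> 0" "\<phi> = 0 \<Longrightarrow> ecoord v e t x = 0 \<and> (v = q \<or> vcoord v e t x = 0)"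
proof -
  note T = tri_coord[OF assms(1)] and E = edge_coord[OF assms(1)]
  have pos: "tri_coord D t r * edge_coord D e p > 0" using T E by simp
  have "\<phi> \<ge> 0 \<and> (\<phi> = 0 \<longrightarrow> ecoord v e t x = 0 \<and> (v = q \<or> vcoord v e t x = 0))"
    using assms(2)
  proof
    assume v: "v = p"
    have m: "0 \<le> vcoord p e t x" "0 \<le> ecoord p e t x" using assms(3) v cell_mem[OF assms(1)] by auto
    have \<phi>: "\<phi> = tri_coord D t r * vcoord p e t x + (tri_coord D t r * edge_coord D e p) * ecoord p e t x"
      unfolding \<phi>_def tau_cell[OF assms(1)] by (simp add: algebra_simps)
    have "tri_coord D t r * vcoord p e t x \<ge> 0" "(tri_coord D t r * edge_coord D e p) * ecoord p e t x \<ge> 0"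
      using T(3) pos m by simp_all
    moreover from this have "\<phi> = 0 \<longrightarrow> tri_coord D t r * vcoord p e t x = 0 \<and> (tri_coord D t r * edge_coord D e p) * ecoord p e t x = 0"
      unfolding \<phi> by linarith
    ultimately show ?thesis using T(3) pos unfolding \<phi> v by auto
  next
    assume v: "v = q"
    have m: "0 \<le> ecoord q e t x" using assms(3) v cell_mem[OF labelled_swap[OF assms(1)]] by auto
    have \<phi>: "\<phi> = (tri_coord D t r * edge_coord D e p) * ecoord q e t x"
      unfolding \<phi>_def tau_cell[OF labelled_swap[OF assms(1)]] by (simp add: algebra_simps)
    show ?thesis unfolding \<phi> v using pos m T(3) E(1) by simp
  qed
  then show "\<phi> \<ge> 0" "\<phi> = 0 \<Longrightarrow> ecoord v e t x = 0 \<and> (v = q \<or> vcoord v e t x = 0)" by blast+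
qed

lemma cell_center:
  assumes "labelled p q r e t" "vcoord p e t x = 0" "ecoord p e t x = 0"
  shows "x = tsplit D t"
  using cell_sum[OF assms(1), of x] assms(2,3) by simp

text \<open>The second labelling exchanges \<open>p\<close> and \<open>r\<close>, so its sign
  function is the negative of the first. Both are nonnegative at \<open>x\<close>, hence zero, and
  \<open>x\<close> lies on the line through \<open>q\<close> and the split point.\<close>

lemma cells_different_edges:
  assumes c: "labelled p q r e t" "labelled r q p e' t" and v: "v = p \<or> v = q" "v' = r \<or> v' = q"
    and x: "x \<in> ps_cell D (v, e, t)" "x \<in> ps_cell D (v', e', t)"
  shows "x = tsplit D t \<or> (v = q \<and> v' = q \<and> ecoord q e t x = 0)"
proof -
  note s = cell_vertex_line_side[OF c(1) v(1) x(1)] and s' = cell_vertex_line_side[OF c(2) v(2) x(2)]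
  have "tri_coord D t r * bary (vertices t) x p - tri_coord D t p * bary (vertices t) x r = 0"
    using s(1) s'(1) by linarith
  then have z: "ecoord v e t x = 0" "v = q \<or> vcoord v e t x = 0" "ecoord v' e' t x = 0" "v' = q \<or> vcoord v' e' t x = 0"
    using s(2) s'(2) by auto
  have "x = tsplit D t" if "vcoord v e t x = 0"
    using v(1) cell_center[OF c(1)] cell_center[OF labelled_swap[OF c(1)]] that z(1) by blast
  moreover have "x = tsplit D t" if "vcoord v' e' t x = 0"
    using v(2) cell_center[OF c(2)] cell_center[OF labelled_swap[OF c(2)]] that z(3) by blast
  ultimately show ?thesis using z by blast
qed

text \<open>The positions of a point common to two cells of one triangle: equal cells, two halves of
  one edge, only the split point, or two cells along the line from a common vertex. Agreement and
  both smoothness claims about lines are decided by these cases.\<close>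

lemma same_triangle_cases:
  assumes k: "labelled v q r e t" "labelled v' q' r' e' t"
    and x: "x \<in> ps_cell D (v, e, t)" "x \<in> ps_cell D (v', e', t)"
  obtains (same) "v = v'" "e = e'"
  | (edge) s where "labelled v v' s e t" "e = e'" "vcoord v e t x = 0"
  | (center) "e \<noteq> e'" "x = tsplit D t"
  | (vertex) p s where "v = v'" "e \<noteq> e'" "labelled v p s e t" "labelled v s p e' t" "ecoord v e t x = 0"
proof (cases "e = e'")
  case True
  then have "v' = v \<or> v' = q" using labelledD(9)[OF k(1)] labelledD(9)[OF k(2)] by auto
  then show thesis
  proof
    assume "v' = q"
    then show thesis using edge[of r] k x True cells_edge_line[OF k(1) x(1)] by blast
  qed (use same True in auto)
next
  case False
  have cs: "closed_segment a b = closed_segment b a" for a b :: pt by (rule closed_segment_commute)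
  have "e' = closed_segment v q \<or> e' = closed_segment q r \<or> e' = closed_segment r v"
    using labelledD(10)[OF k(2)] edge_of_triangle[OF labelledD(2)[OF k(1)], of e'] labelledD(3)[OF k(1)] by blast
  then have e': "e' = closed_segment q r \<or> e' = closed_segment r v"
    using False labelledD(4)[OF k(1)] by blast
  \<comment> \<open>Two distinct edges of a triangle share a vertex; it is called
    \<open>Q\<close>.\<close>
  obtain P Q R where c: "labelled P Q R e t" "labelled R Q P e' t" and v: "v = P \<or> v = Q"
  proof -
    from e' show thesis
    proof
      assume e: "e' = closed_segment q r"
      have "labelled r q v e' t" using labelled_swap[OF labelled_rot[OF k(1)]] e by simp
      then show thesis using that k(1) by blast
    next
      assume e: "e' = closed_segment r v"
      have "labelled r v q e' t" using labelled_rot[OF labelled_rot[OF k(1)]] e by simp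
      then show thesis using that[of q v r] labelled_swap[OF k(1)] by blast
    qed
  qed
  have "v' = R \<or> v' = Q" using labelledD(9)[OF c(2)] labelledD(9)[OF k(2)] by auto
  from cells_different_edges[OF c v this x] show thesis
    using center vertex[of P R] False labelled_swap[OF c(1)] labelled_swap[OF c(2)] by blast
qed

lemma vertex_in_cell:
  assumes "labelled p q r e t" "x \<in> vertices t" "x \<in> ps_cell D (p, e, t)"
  shows "x = p" "vcoord p e t x = 1" "ecoord p e t x = 0" "tcoord p e t x = 0"
proof -
  note d = labelledD[OF assms(1)] and T = tri_coord[OF assms(1)] and E = edge_coord[OF assms(1)]
    and tau = tau_cell[OF assms(1), of x, unfolded d(8)] and b = bary_vertex[OF d(2)]
  have m: "0 \<le> vcoord p e t x" "0 \<le> ecoord p e t x" "0 \<le> tcoord p e t x" using assms(3) cell_mem[OF assms(1)] by auto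
  have s: "vcoord p e t x + ecoord p e t x + tcoord p e t x = 1" by (rule cell_sum(1)[OF assms(1)])
  have nn: "0 \<le> ecoord p e t x * edge_coord D e p" "0 \<le> tcoord p e t x * tri_coord D t p"
    "0 \<le> ecoord p e t x * edge_coord D e q" "0 \<le> tcoord p e t x * tri_coord D t q"
    using m T E by simp_all
  have "bary {p, q, r} x p \<noteq> 0"
  proof
    assume "bary {p, q, r} x p = 0"
    then have "vcoord p e t x = 0" "ecoord p e t x * edge_coord D e p = 0" "tcoord p e t x * tri_coord D t p = 0"
      using tau(1) nn m by linarith+
    then show False using s E(1) T(1) by simp
  qed
  then show xp: "x = p" using assms(2) d(8) b by auto
  have "bary {p, q, r} x q = 0" using xp b by simp
  then have "ecoord p e t x * edge_coord D e q = 0" "tcoord p e t x * tri_coord D t q = 0"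
    using tau(2) nn by linarith+
  then show "ecoord p e t x = 0" "tcoord p e t x = 0" using E(2) T(2) by simp_all
  with s show "vcoord p e t x = 1" by simp
qed

text \<open>A small triangle meets the boundary of \<open>t\<close> only in its half of the edge.
  The coordinates in \<open>t\<close> are sums of nonnegative terms, so a vanishing coordinate
  annihilates each of its terms.\<close>

lemma cell_on_face:
  assumes "labelled p q r e t" "x \<in> ps_cell D (p, e, t)" "x \<in> convex hull C" "C \<subset> vertices t" "x \<notin> vertices t"
  shows "C = {p, q}" "tcoord p e t x = 0"
proof -
  note d = labelledD[OF assms(1)] and T = tri_coord[OF assms(1)] and E = edge_coord[OF assms(1)]
    and tau = tau_cell[OF assms(1), of x]
  have m: "0 \<le> vcoord p e t x" "0 \<le> ecoord p e t x" "0 \<le> tcoord p e t x" using assms(2) cell_mem[OF assms(1)] by auto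
  have s: "vcoord p e t x + ecoord p e t x + tcoord p e t x = 1" by (rule cell_sum(1)[OF assms(1)])
  have nn: "0 \<le> ecoord p e t x * edge_coord D e p" "0 \<le> tcoord p e t x * tri_coord D t p"
    "0 \<le> ecoord p e t x * edge_coord D e q" "0 \<le> tcoord p e t x * tri_coord D t q"
    using m T E by simp_all
  have ind: "\<not> affine_dependent (vertices t)" "finite (vertices t)"
    using noncollinear_distinct[OF d(2)] d(8) by simp_all
  have off: "bary (vertices t) x w = 0" if "w \<notin> C" for w
    using bary_common_face(2)[OF ind _ ind _ assms(3) that] assms(4) by blast
  have p: "p \<in> C"
  proof (rule ccontr)
    assume "p \<notin> C"
    from off[OF this] have "vcoord p e t x = 0" "ecoord p e t x * edge_coord D e p = 0" "tcoord p e t x * tri_coord D t p = 0"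
      using tau(1) nn m by linarith+
    then show False using s E(1) T(1) by simp
  qed
  have q: "q \<in> C"
  proof (rule ccontr)
    assume "q \<notin> C"
    from off[OF this] have "ecoord p e t x * edge_coord D e q = 0" "tcoord p e t x * tri_coord D t q = 0"
      using tau(2) nn by linarith+
    then have "ecoord p e t x = 0" "tcoord p e t x = 0" using E(2) T(2) by simp_all
    then have "x = p" using cell_sum[OF assms(1), of x] by simp
    then show False using assms(5) d(8) by simp
  qed
  show C: "C = {p, q}" using p q assms(4) unfolding d(8) by auto
  have "r \<notin> C" using d(5-7) C by simp
  from off[OF this] have "tcoord p e t x * tri_coord D t r = 0" using tau(3) by simp
  then show "tcoord p e t x = 0" using T(3) by simp
qed

end

context ps_coeffs
begin

section \<open>Agreement of the pieces on common points\<close>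

lemma pieces_agree_same_triangle:
  assumes k: "labelled v q r e t" "labelled v' q' r' e' t"
    and x: "x \<in> ps_cell D (v, e, t)" "x \<in> ps_cell D (v', e', t)"
  shows "piece (v, e, t) x = piece (v', e', t) x"
  using k x
proof (cases rule: same_triangle_cases)
  case same
  then show ?thesis by simp
next
  case (edge s)
  then show ?thesis using piece_across_edge_line[OF edge(1), of x] by simp
next
  case center
  then show ?thesis using same_derivs2_center[OF k] by (simp add: same_derivs2_def)
next
  \<comment> \<open>On this line only the terms \<alpha> \<gamma>^2 and \<gamma>^3 survive, and both
    are symmetric in the two edges at \<open>v\<close>.\<close>
  case (vertex p s)
  have s: "vcoord v e t x + 0 + tcoord v e t x = 1" "x = vcoord v e t x *\<^sub>R v + 0 *\<^sub>R esplit D e' + tcoord v e t x *\<^sub>R tsplit D t"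
    using cell_sum[OF vertex(3), of x] vertex(5) by simp_all
  note u = cell_unique[OF vertex(4) s]
  show ?thesis
    unfolding vertex(1)[symmetric] piece_eq[OF vertex(3)] piece_eq[OF vertex(4)] u vertex(5) cell_poly_def
      closed_segment_commute[of s p]
    by (simp add: algebra_simps)
qed

lemma piece_at_vertex:
  assumes "labelled p q r e t" "x \<in> vertices t" "x \<in> ps_cell D (p, e, t)"
  shows "piece (p, e, t) x = 0"
  unfolding piece_eq[OF assms(1)] cell_poly_def vertex_in_cell(2-4)[OF assms] by simp

text \<open>At a vertex all pieces vanish. Any other common point lies on a common edge, where the
  pieces involve only the edge mean and the position of the edge split point.\<close>

lemma pieces_agree_different_triangles:
  assumes k: "labelled v q r e t" "labelled v' q' r' e' t'" and ne: "t \<noteq> t'"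
    and x: "x \<in> ps_cell D (v, e, t)" "x \<in> ps_cell D (v', e', t')"
  shows "piece (v, e, t) x = piece (v', e', t') x"
proof -
  note d = labelledD[OF k(1)] and d' = labelledD[OF k(2)]
  have xt: "x \<in> t \<inter> t'" using cell_subset k x by blast
  have ind: "\<not> affine_dependent (vertices t)" "finite (vertices t)" "\<not> affine_dependent (vertices t')" "finite (vertices t')"
    using noncollinear_distinct[OF d(2)] noncollinear_distinct[OF d'(2)] d(8) d'(8) by simp_all
  have hull: "convex hull (vertices t) = t" "convex hull (vertices t') = t'"
    using d(3,8) d'(3,8) by simp_all
  have "(t \<inter> t') face_of t'" using conforming[OF d'(1) d(1)] by (simp add: Int_commute)
  then obtain C where C: "C \<subseteq> vertices t" "C \<subseteq> vertices t'" "t \<inter> t' = convex hull C"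
    using hull_face_subset[OF ind(1,3), of "t \<inter> t'"] conforming[OF d(1) d'(1)] hull by metis
  have three: "card (vertices t) = 3" "card (vertices t') = 3"
    using d(5-8) d'(5-8) by simp_all
  have "C \<noteq> vertices t"
  proof
    assume "C = vertices t"
    then have "vertices t = vertices t'" using C(2) three ind(4) card_subset_eq by metis
    then show False using hull ne by simp
  qed
  moreover have "C \<noteq> vertices t'"
  proof
    assume "C = vertices t'"
    then have "vertices t' = vertices t" using C(1) three ind(2) card_subset_eq by metis
    then show False using hull ne by simp
  qed
  ultimately have proper: "C \<subset> vertices t" "C \<subset> vertices t'" using C by blast+
  have xC: "x \<in> convex hull C" using xt C(3) by simp
  have ext: "x \<in> C" if "x \<in> vertices t \<or> x \<in> vertices t'"
  proof -
    have "x extreme_point_of t \<or> x extreme_point_of t'" using that by (simp add: vertices_def)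
    then have "x extreme_point_of (convex hull C)"
      using xC C(3) unfolding extreme_point_of_def by blast
    then show ?thesis by (rule extreme_point_of_convex_hull)
  qed
  show ?thesis
  proof (cases "x \<in> C")
    case True
    then have "x \<in> vertices t" "x \<in> vertices t'" using C by blast+
    then show ?thesis using piece_at_vertex[OF k(1) _ x(1)] piece_at_vertex[OF k(2) _ x(2)] by simp
  next
    case False
    then have nv: "x \<notin> vertices t" "x \<notin> vertices t'" using ext by blast+
    note f = cell_on_face[OF k(1) x(1) xC proper(1) nv(1)] and f' = cell_on_face[OF k(2) x(2) xC proper(2) nv(2)]
    have vq: "{v, q} = {v', q'}" using f(1) f'(1) by simp
    then have cases: "v' = v \<and> q' = q \<or> v' = q \<and> q' = v" using d(5) d'(5) by (auto simp: doubleton_eq_iff)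
    then have ee: "e' = e" using d(4) d'(4) closed_segment_commute by metis
    have mm: "edge_mean e t' = edge_mean e t"
      using edge_mean_shared[OF d'(1) d(1)] d(10) d'(10) ee by simp
    have same: "bary (vertices t) x w = bary (vertices t') x w" for w
      using bary_common_face(1)[OF ind(1,2) C(1) ind(3,4) C(2) xC] by simp
    note E = edge_coord[OF k(1)]
    have tau: "bary (vertices t) x q = ecoord v e t x * edge_coord D e q" "bary (vertices t) x v = vcoord v e t x + ecoord v e t x * edge_coord D e v"
      using tau_cell(1,2)[OF k(1), of x] f(2) by simp_all
    have s: "vcoord v e t x = 1 - ecoord v e t x" using cell_sum(1)[OF k(1), of x] f(2) by simp
    have tau': "bary (vertices t') x q' = ecoord v' e t' x * edge_coord D e q'"
      using tau_cell(2)[OF k(2), of x] f'(2) ee by simp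
    have s': "vcoord v' e t' x = 1 - ecoord v' e t' x" using cell_sum(1)[OF k(2), of x] f'(2) ee by simp
    from cases show ?thesis
    proof
      assume eq: "v' = v \<and> q' = q"
      then have "ecoord v e t' x = ecoord v e t x" using tau(1) tau' same[of q] E(2) by simp
      then show ?thesis
        using piece_eq[OF k(1), of x] piece_eq[OF k(2), of x] eq f(2) f'(2) s s' mm
        by (simp add: cell_poly_def ee)
    next
      \<comment> \<open>The point lies in the two opposite halves of the edge, so it must be the
        edge split point, where both edge coordinates equal 1.\<close>
      assume eq: "v' = q \<and> q' = v"
      have m: "0 \<le> vcoord v e t x" "0 \<le> vcoord q e t' x"
        using x cell_mem[OF k(1)] cell_mem[OF k(2)] eq ee by auto
      have le: "ecoord v e t x \<le> 1" "ecoord q e t' x \<le> 1" using m s s' eq by simp_all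
      have "ecoord q e t' x * edge_coord D e v = 1 - ecoord v e t x + ecoord v e t x * edge_coord D e v"
        using tau(2) tau' same[of v] s eq by simp
      moreover have "edge_coord D e q = 1 - edge_coord D e v" using E(3) by simp
      ultimately have "(1 - ecoord q e t' x) * edge_coord D e v + (1 - ecoord v e t x) * edge_coord D e q = 0"
        by algebra
      moreover have "(1 - ecoord q e t' x) * edge_coord D e v \<ge> 0" "(1 - ecoord v e t x) * edge_coord D e q \<ge> 0"
        using le E by simp_all
      ultimately have "(1 - ecoord q e t' x) * edge_coord D e v = 0" "(1 - ecoord v e t x) * edge_coord D e q = 0"
        by linarith+
      then have "ecoord q e t' x = 1" "ecoord v e t x = 1" using E by simp_all
      then show ?thesis
        using piece_eq[OF k(1), of x] piece_eq[OF k(2), of x] eq f(2) f'(2) s s' mm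
        by (simp add: cell_poly_def ee)
    qed
  qed
qed

lemma pieces_agree:
  assumes "k \<in> ps_index D" "k' \<in> ps_index D" "x \<in> ps_cell D k" "x \<in> ps_cell D k'"
  shows "piece k x = piece k' x"
proof -
  obtain v e t v' e' t' where k: "k = (v, e, t)" "k' = (v', e', t')" using prod_cases3 by metis
  obtain q r q' r' where c: "labelled v q r e t" "labelled v' q' r' e' t'"
    using assms(1,2) unfolding k index_labelled by blast
  show ?thesis
    using pieces_agree_same_triangle pieces_agree_different_triangles[OF c] c assms(3,4)
    unfolding k by (cases "t = t'") blast+
qed

text \<open>The smoothness predicates index pieces by cells as point sets, so an index triple has to
  be chosen for each cell.\<close>

definition spline_piece :: "pt set \<Rightarrow> pt \<Rightarrow> real" where
  "spline_piece S = piece (SOME k. k \<in> ps_index D \<and> ps_cell D k = S)"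

lemma spline_piece:
  assumes "S \<in> ps_cells D"
  obtains v q r e t where "labelled v q r e t" "S = ps_cell D (v, e, t)" "spline_piece S = piece (v, e, t)"
proof -
  define k where "k = (SOME k. k \<in> ps_index D \<and> ps_cell D k = S)"
  have "\<exists>k. k \<in> ps_index D \<and> ps_cell D k = S" using assms by (auto simp: ps_cells_def)
  then have k: "k \<in> ps_index D \<and> ps_cell D k = S" unfolding k_def by (rule someI_ex)
  obtain v e t where vet: "k = (v, e, t)" using prod_cases3 by metis
  have "(v, e, t) \<in> ps_index D" using k vet by simp
  then obtain q r where "labelled v q r e t" unfolding index_labelled by blast
  moreover have "S = ps_cell D (v, e, t)" "spline_piece S = piece (v, e, t)"
    using k vet unfolding spline_piece_def k_def[symmetric] by simp_all
  ultimately show thesis using that by blast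
qed

text \<open>\<open>ps_spline\<close> chooses a triple for each point and \<open>spline_piece\<close>
  one for each cell; the agreement of pieces reconciles the two choices.\<close>

lemma polynomial_pieces_spline:
  "polynomial_pieces (ps_cells D) (ps_spline D (\<lambda>_ _. 0) c) spline_piece"
  unfolding polynomial_pieces_def
proof (intro ballI conjI)
  fix S assume S: "S \<in> ps_cells D"
  obtain v q r e t where c: "labelled v q r e t" "S = ps_cell D (v, e, t)" "spline_piece S = piece (v, e, t)"
    using spline_piece[OF S] .
  show "real_polynomial_function (spline_piece S)" unfolding c(3) by (rule real_polynomial_piece[OF c(1)])
  fix x assume x: "x \<in> S"
  have i: "(v, e, t) \<in> ps_index D" using c(1) index_labelled by blast
  then have "\<exists>k. k \<in> ps_index D \<and> x \<in> ps_cell D k" using x c(2) by blast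
  then have "(SOME k. k \<in> ps_index D \<and> x \<in> ps_cell D k) \<in> ps_index D \<and> x \<in> ps_cell D (SOME k. k \<in> ps_index D \<and> x \<in> ps_cell D k)"
    by (rule someI_ex)
  then have "piece (SOME k. k \<in> ps_index D \<and> x \<in> ps_cell D k) x = piece (v, e, t) x"
    using pieces_agree i x c(2) by blast
  then show "ps_spline D (\<lambda>_ _. 0) c x = spline_piece S x"
    unfolding ps_spline_def c(3) using S x by auto
qed

section \<open>Smoothness at split points and across edge lines\<close>

lemma C2_at_split_point:
  assumes "t \<in> triangles D"
  shows "C2_at (ps_cells D) (ps_spline D (\<lambda>_ _. 0) c) (tsplit D t)"
  unfolding C2_at_def
proof (intro exI conjI ballI impI)
  fix S S' assume S: "S \<in> ps_cells D" "S' \<in> ps_cells D" and x: "tsplit D t \<in> S \<and> tsplit D t \<in> S'"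
  have i: "tsplit D t \<in> interior t" using split_points assms by (simp add: ps_split_points_def)
  obtain v q r e u where c: "labelled v q r e u" "S = ps_cell D (v, e, u)" "spline_piece S = piece (v, e, u)"
    using spline_piece[OF S(1)] .
  obtain v' q' r' e' u' where c': "labelled v' q' r' e' u'" "S' = ps_cell D (v', e', u')" "spline_piece S' = piece (v', e', u')"
    using spline_piece[OF S(2)] .
  have "u = t" "u' = t"
    using interior_triangles_eq[OF assms _ i] labelledD(1)[OF c(1)] labelledD(1)[OF c'(1)] cell_subset[OF c(1)] cell_subset[OF c'(1)] x c(2) c'(2)
    by blast+
  then show "same_derivs2 (spline_piece S) (spline_piece S') (tsplit D t)"
    unfolding c(3) c'(3) using same_derivs2_center c(1) c'(1) by blast
qed (rule polynomial_pieces_spline)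

lemma C2_across_edge_line:
  assumes "t \<in> triangles D" "e edge_of t"
  shows "C2_across (ps_cells D) (ps_spline D (\<lambda>_ _. 0) c) (closed_segment (esplit D e) (tsplit D t))"
  unfolding C2_across_def
proof (intro exI conjI ballI impI)
  let ?s = "closed_segment (esplit D e) (tsplit D t)"
  fix S S' x assume S: "S \<in> ps_cells D" "S' \<in> ps_cells D" and s: "?s edge_of S \<and> ?s edge_of S'" and x: "x \<in> ?s"
  have i: "tsplit D t \<in> interior t" using split_points assms by (simp add: ps_split_points_def)
  have sub: "?s \<subseteq> S" "?s \<subseteq> S'" using s edge_of_imp_subset by blast+
  obtain v q r e1 u where c: "labelled v q r e1 u" "S = ps_cell D (v, e1, u)" "spline_piece S = piece (v, e1, u)"
    using spline_piece[OF S(1)] .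
  obtain v' q' r' e1' u' where c': "labelled v' q' r' e1' u'" "S' = ps_cell D (v', e1', u')" "spline_piece S' = piece (v', e1', u')"
    using spline_piece[OF S(2)] .
  have "tsplit D t \<in> S" "tsplit D t \<in> S'" using sub by auto
  then have u: "u = t" "u' = t"
    using interior_triangles_eq[OF assms(1) _ i] labelledD(1)[OF c(1)] labelledD(1)[OF c'(1)] cell_subset[OF c(1)] cell_subset[OF c'(1)] c(2) c'(2)
    by blast+
  obtain a b d where abc: "labelled a b d e t" using edge_labelled[OF assms] .
  have ne: "esplit D e \<noteq> tsplit D t" using noncollinear_distinct[OF cell_noncollinear[OF abc]] by blast
  \<comment> \<open>A cell at another edge meets the cell \<open>(a, e, t)\<close> only in the split
    point of \<open>t\<close> or where the edge coordinate is 0, whereas that coordinate is 1 at the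
    edge split point.\<close>
  have edge: "w = e" if w: "labelled v q r w t" "esplit D e \<in> ps_cell D (v, w, t)" for v q r w
  proof -
    have "esplit D e \<in> ps_cell D (a, e, t)" using cell_mem[OF abc] cell_split[OF abc] by simp
    from abc w(1) this w(2) show ?thesis
    proof (cases rule: same_triangle_cases)
      case (vertex p s)
      then show ?thesis using cell_split[OF abc] by simp
    qed (use ne in auto)
  qed
  have E: "esplit D e \<in> S" "esplit D e \<in> S'" using sub by auto
  have e1: "e1 = e" "e1' = e" using edge c c' u E by blast+
  have "x \<in> ps_cell D (v, e, t)" "x \<in> ps_cell D (v', e, t)" using sub x c(2) c'(2) u e1 by auto
  with c(1)[unfolded u e1] c'(1)[unfolded u e1]
  have "same_derivs2 (piece (v, e, t)) (piece (v', e, t)) x"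
  proof (cases rule: same_triangle_cases)
    case same
    then show ?thesis by (simp add: same_derivs2_def)
  next
    case (edge s)
    then show ?thesis using same_derivs2_sym[OF same_derivs2_across_edge_line] by blast
  qed auto
  then show "same_derivs2 (spline_piece S) (spline_piece S') x"
    unfolding c(3) c'(3) u e1 .
qed (rule polynomial_pieces_spline)

end


section \<open>Symmetric triangles and reduced functions\<close>

context ps_mesh
begin

text \<open>The neighbour across \<open>e\<close> is the reflection of \<open>t\<close> in the
  midpoint of \<open>e\<close>. The segment between the two barycenters therefore crosses
  \<open>e\<close> at the midpoint of both, which fixes all weights.\<close>

lemma sym_triangleE:
  assumes sym: "t \<in> sym_triangles D" and c: "labelled p q r e t"
  obtains t' where "t' \<in> triangles D" "e edge_of t'" "t' \<noteq> t"
    "tri_coord D t p = 1/3" "tri_coord D t q = 1/3" "tri_coord D t r = 1/3"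
    "edge_coord D e p = 1/2" "edge_coord D e q = 1/2"
    "bary {tsplit D t, tsplit D t'} (esplit D e) (tsplit D t) = 1/2"
    "bary {tsplit D t, tsplit D t'} (esplit D e) (tsplit D t') = 1/2"
proof -
  note d = labelledD[OF c]
  obtain v1 v2 v3 where v: "t = convex hull {v1, v2, v3}"
    and N: "neighbours (triangles D) t =
             {convex hull {v1, v2, v1 + v2 - v3}, convex hull {v2, v3, v2 + v3 - v1}, convex hull {v3, v1, v3 + v1 - v2}}"
    and B: "\<forall>t'\<in>insert t (neighbours (triangles D) t). tsplit D t' = barycenter t'"
    using sym unfolding sym_triangles_def by blast
  have "\<not> collinear {v1, v2, v3}" using simplex[OF d(1)] v simplex2_noncollinear by blast
  then have V: "{p, q, r} = {v1, v2, v3}" using vertices_triangle v d(8) by metis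
  define t' where "t' = convex hull {p, q, p + q - r}"
  have "p \<in> {v1, v2, v3}" "q \<in> {v1, v2, v3}" "r \<in> {v1, v2, v3}" using V by blast+
  \<comment> \<open>The definition of symmetry fixes one order of the vertices, while the labelling
    may use any of the six.\<close>
  then consider "p = v1" "q = v2" "r = v3" | "p = v2" "q = v1" "r = v3" | "p = v2" "q = v3" "r = v1"
    | "p = v3" "q = v2" "r = v1" | "p = v3" "q = v1" "r = v2" | "p = v1" "q = v3" "r = v2"
    using d(5-7) by blast
  then have t'N: "t' \<in> neighbours (triangles D) t"
    unfolding N t'_def by cases (simp_all add: insert_commute add.commute)
  then have t': "t' \<in> triangles D" "t' \<noteq> t" by (auto simp: neighbours_def)
  have "cross2 p q (p + q - r) = - cross2 p q r" by (simp add: cross2_def algebra_simps)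
  then have nc': "\<not> collinear {p, q, p + q - r}" using d(2) by (simp add: collinear_iff_cross2)
  then have c': "labelled p q (p + q - r) e t'" using t' d(4) unfolding labelled_def t'_def by simp
  note d' = labelledD[OF c']
  have M: "tsplit D t = (1/3) *\<^sub>R p + (1/3) *\<^sub>R q + (1/3) *\<^sub>R r"
    using B d(5-7) by (simp add: barycenter_def d(8) scaleR_add_right add.assoc)
  have M': "tsplit D t' = (2/3) *\<^sub>R p + (2/3) *\<^sub>R q + (- 1/3) *\<^sub>R r"
  proof -
    have "tsplit D t' = (1/3) *\<^sub>R (p + (q + (p + q - r)))"
      using B t'N d'(5-7) by (simp add: barycenter_def d'(8))
    also have "\<dots> = (2/3) *\<^sub>R p + (2/3) *\<^sub>R q + (- 1/3) *\<^sub>R r"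
      by (simp add: vec_eq_iff) 
    finally show ?thesis .
  qed
  have tri: "tri_coord D t p = 1/3" "tri_coord D t q = 1/3" "tri_coord D t r = 1/3"
    unfolding tri_coord_def d(8) using bary3_unique[OF d(2) _ M] by simp_all
  have "esplit D e \<in> closed_segment (tsplit D t) (tsplit D t')"
    using split_points d(1,10) d'(1,10) t'(2) unfolding ps_split_points_def by blast
  then obtain u where u: "esplit D e = (1 - u) *\<^sub>R tsplit D t + u *\<^sub>R tsplit D t'"
    by (auto simp: in_segment)
  have "(1 - u) *\<^sub>R tsplit D t + u *\<^sub>R tsplit D t' =
      ((1 + u) / 3) *\<^sub>R p + ((1 + u) / 3) *\<^sub>R q + ((1 - 2 * u) / 3) *\<^sub>R r"
    unfolding M M' by (simp add: vec_eq_iff) (simp add: field_simps)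
  with u have "esplit D e = ((1 + u) / 3) *\<^sub>R p + ((1 + u) / 3) *\<^sub>R q + ((1 - 2 * u) / 3) *\<^sub>R r"
    by simp
  note 1 = bary3_unique[OF d(2) _ this]
  note E = edge_coord[OF c]
  \<comment> \<open>A second expansion of the same point: it lies on \<open>e\<close>, so its
    coordinate (1 - 2 u) / 3 at \<open>r\<close> vanishes and \<open>u\<close> is 1/2.\<close>
  have "esplit D e = edge_coord D e p *\<^sub>R p + edge_coord D e q *\<^sub>R q + 0 *\<^sub>R r" using E(4) by simp
  note 2 = bary3_unique[OF d(2) _ this]
  have "(1 - 2 * u) / 3 = 0" "edge_coord D e p = (1 + u) / 3" "edge_coord D e q = (1 + u) / 3"
    using 1(1-3) 2(1-3) E(3) by (simp_all add: field_simps)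
  then have uh: "u = 1/2" and e: "edge_coord D e p = 1/2" "edge_coord D e q = 1/2" by simp_all
  have ne: "tsplit D t \<noteq> tsplit D t'"
  proof
    assume eq: "tsplit D t = tsplit D t'"
    have "tsplit D t \<in> interior t" "tsplit D t' \<in> interior t'"
      using split_points d(1) d'(1) by (simp_all add: ps_split_points_def)
    then have "tsplit D t \<in> interior t" "tsplit D t \<in> t'"
      using eq interior_subset by (simp, metis subsetD)
    then show False using interior_triangles_eq[OF d(1) d'(1)] t'(2) by blast
  qed
  have "esplit D e = (1/2) *\<^sub>R tsplit D t + (1/2) *\<^sub>R tsplit D t'" using u uh by simp
  note b = bary2_unique[OF ne _ this]
  show thesis
    using that[OF t'(1) d'(10) t'(2) tri e] b by simp
qed

lemma sym_triangle_other:
  assumes "t \<in> sym_triangles D" "e edge_of t"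
  shows "t \<in> triangles D" "other_triangle (triangles D) e t \<in> triangles D"
    "e edge_of other_triangle (triangles D) e t" "other_triangle (triangles D) e t \<noteq> t"
    "\<not> boundary_edge (triangles D) e"
proof -
  show t: "t \<in> triangles D" using assms(1) by (simp add: sym_triangles_def)
  obtain p q r where "labelled p q r e t" using edge_labelled[OF t assms(2)] .
  then obtain t' where t': "t' \<in> triangles D" "e edge_of t'" "t' \<noteq> t"
    using sym_triangleE[OF assms(1)] by metis
  note o = other_triangle_eq[OF t t'(1) assms(2) t'(2) t'(3)[symmetric]]
  show "other_triangle (triangles D) e t \<in> triangles D"
    "e edge_of other_triangle (triangles D) e t" "other_triangle (triangles D) e t \<noteq> t"
    "\<not> boundary_edge (triangles D) e"
    using o t' by simp_all
qed

text \<open>For the coefficients of a twice reduced function, \<open>2 g e t - g e t'\<close> with the other triangle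
  \<open>t'\<close> at \<open>e\<close> recovers the coefficient at \<open>(\<emptyset>, t)\<close> from its \<open>2/3 : 1/3\<close> averages.\<close>

definition balanced :: "(pt set \<Rightarrow> pt set \<Rightarrow> real) \<Rightarrow> bool" where
  "balanced g \<longleftrightarrow> (\<forall>t\<in>sym_triangles D. \<exists>K. \<forall>e. e edge_of t \<longrightarrow>
     2 * g e t - g e (other_triangle (triangles D) e t) = K)"

end

locale ps_reduced = ps_coeffs +
  assumes balanced_coeffs: "balanced g"
begin

lemma balanced_edges:
  assumes "t \<in> sym_triangles D" "e edge_of t" "e' edge_of t"
  shows "2 * g e t - g e (other_triangle (triangles D) e t) = 2 * g e' t - g e' (other_triangle (triangles D) e' t)"
  using balanced_coeffs assms unfolding balanced_def by metis

text \<open>The mean is (g + g') / 2 here. It is written through 2 g - g', the quantity that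
  \<open>balanced\<close> makes common to the three edges.\<close>

lemma sym_edge_mean:
  assumes "t \<in> sym_triangles D" "labelled p q r e t"
  shows "edge_mean e t = (3 * g e t - (2 * g e t - g e (other_triangle (triangles D) e t))) / 2"
proof -
  obtain t' where t': "t' \<in> triangles D" "e edge_of t'" "t' \<noteq> t"
    "bary {tsplit D t, tsplit D t'} (esplit D e) (tsplit D t) = 1/2"
    "bary {tsplit D t, tsplit D t'} (esplit D e) (tsplit D t') = 1/2"
    using sym_triangleE[OF assms] by metis
  note o = other_triangle_eq[OF labelledD(1)[OF assms(2)] t'(1) labelledD(10)[OF assms(2)] t'(2) t'(3)[symmetric]]
  show ?thesis unfolding edge_mean_def by (simp add: o Let_def t'(4,5))
qed

lemma sym_coords:
  assumes "t \<in> sym_triangles D" "labelled q p r e t" "labelled q r p e' t"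
  shows "vcoord q e' t x = vcoord q e t x + ecoord q e t x / 2" "ecoord q e' t x = - ecoord q e t x"
    "tcoord q e' t x = tcoord q e t x + 3 / 2 * ecoord q e t x"
proof -
  have s: "edge_coord D e q = 1/2" "edge_coord D e p = 1/2" "tri_coord D t q = 1/3"
     "tri_coord D t p = 1/3" "tri_coord D t r = 1/3"
    using sym_triangleE[OF assms(1,2)] by metis+
  have s': "edge_coord D e' q = 1/2" "edge_coord D e' r = 1/2"
    using sym_triangleE[OF assms(1,3)] by metis+
  \<comment> \<open>The midpoints of the two edges at \<open>q\<close> sum to q + (p + r) / 2, which
    is half of \<open>q\<close> plus 3/2 of the barycenter.\<close>
  have E: "esplit D e = (1/2) *\<^sub>R q + (3/2) *\<^sub>R tsplit D t - esplit D e'"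
    unfolding edge_coord(4)[OF assms(2)] edge_coord(4)[OF assms(3)] tri_coord(5)[OF assms(2)] s s'
    by (simp add: vec_eq_iff add_divide_distrib)
  have "x = vcoord q e t x *\<^sub>R q + ecoord q e t x *\<^sub>R ((1/2) *\<^sub>R q + (3/2) *\<^sub>R tsplit D t - esplit D e') + tcoord q e t x *\<^sub>R tsplit D t"
    using cell_sum(2)[OF assms(2), of x] unfolding E .
  also have "\<dots> = (vcoord q e t x + ecoord q e t x / 2) *\<^sub>R q + (- ecoord q e t x) *\<^sub>R esplit D e'
      + (tcoord q e t x + 3 / 2 * ecoord q e t x) *\<^sub>R tsplit D t"
    by (simp add: vec_eq_iff algebra_simps)
  finally have x: "x = \<dots>" .
  have "(vcoord q e t x + ecoord q e t x / 2) + (- ecoord q e t x) + (tcoord q e t x + 3 / 2 * ecoord q e t x) = 1"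
    using cell_sum(1)[OF assms(2), of x] by simp
  from cell_unique[OF assms(3) this x]
  show "vcoord q e' t x = vcoord q e t x + ecoord q e t x / 2" "ecoord q e' t x = - ecoord q e t x"
    "tcoord q e' t x = tcoord q e t x + 3 / 2 * ecoord q e t x" .
qed

lemma same_derivs2_across_vertex_line:
  assumes sym: "t \<in> sym_triangles D" and c: "labelled q p r e t" "labelled q r p e' t" and x: "ecoord q e t x = 0"
  shows "same_derivs2 (piece (q, e', t)) (piece (q, e, t)) x"
proof (rule same_derivs2I[OF real_polynomial_piece[OF c(1)]])
  note d = labelledD[OF c(1)] and d' = labelledD[OF c(2)]
  have s: "edge_coord D e q = 1/2" "edge_coord D e p = 1/2" "tri_coord D t q = 1/3"
     "tri_coord D t p = 1/3" "tri_coord D t r = 1/3"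
    using sym_triangleE[OF sym c(1)] by metis+
  have s': "edge_coord D e' q = 1/2" "edge_coord D e' r = 1/2"
    using sym_triangleE[OF sym c(2)] by metis+
  define K where "K = 2 * g e t - g e (other_triangle (triangles D) e t)"
  have m: "edge_mean e t = (3 * g e t - K) / 2" "edge_mean e' t = (3 * g e' t - K) / 2"
    using sym_edge_mean[OF sym c(1)] sym_edge_mean[OF sym c(2)] balanced_edges[OF sym d(10) d'(10)]
    by (simp_all add: K_def)
  define k where "k = edge_mean e' t / 4 - edge_mean e t / 2 + 3 / 4 * g e t - 3 / 8 * g e' t
    - 3 / 8 * g (closed_segment p r) t"
  show "flat2 (\<lambda>y. k * (ecoord q e t y * ecoord q e t y * ecoord q e t y)) x"
    by (intro flat2_product cell_poly_coords[OF c(1)] x)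
  fix y
  show "piece (q, e', t) y = piece (q, e, t) y + k * (ecoord q e t y * ecoord q e t y * ecoord q e t y)"
    unfolding piece_eq[OF c(1)] piece_eq[OF c(2)] s s' sym_coords[OF sym c] closed_segment_commute[of r p]
      d(4)[symmetric] d'(4)[symmetric] cell_poly_across_vertex_line[OF m]
    by (simp add: k_def power3_eq_cube)
qed

lemma C2_at_sym_interior:
  assumes sym: "t \<in> sym_triangles D" and i: "x \<in> interior t"
  shows "C2_at (ps_cells D) (ps_spline D (\<lambda>_ _. 0) c) x"
  unfolding C2_at_def
proof (intro exI conjI ballI impI)
  have t: "t \<in> triangles D" using sym by (simp add: sym_triangles_def)
  fix S S' assume S: "S \<in> ps_cells D" "S' \<in> ps_cells D" and x: "x \<in> S \<and> x \<in> S'"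
  obtain v q r e u where k: "labelled v q r e u" "S = ps_cell D (v, e, u)" "spline_piece S = piece (v, e, u)"
    using spline_piece[OF S(1)] .
  obtain v' q' r' e' u' where k': "labelled v' q' r' e' u'" "S' = ps_cell D (v', e', u')" "spline_piece S' = piece (v', e', u')"
    using spline_piece[OF S(2)] .
  have u: "u = t" "u' = t"
    using interior_triangles_eq[OF t _ i] labelledD(1)[OF k(1)] labelledD(1)[OF k'(1)] cell_subset[OF k(1)] cell_subset[OF k'(1)] x k(2) k'(2)
    by blast+
  note c = k(1)[unfolded u] k'(1)[unfolded u]
  have "x \<in> ps_cell D (v, e, t)" "x \<in> ps_cell D (v', e', t)" using x k(2) k'(2) u by auto
  with c have "same_derivs2 (piece (v, e, t)) (piece (v', e', t)) x"
  proof (cases rule: same_triangle_cases)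
    case same
    then show ?thesis by (simp add: same_derivs2_def)
  next
    case (edge s)
    then show ?thesis using same_derivs2_sym[OF same_derivs2_across_edge_line] by blast
  next
    case center
    then show ?thesis using same_derivs2_center[OF c] by simp
  next
    case (vertex p s)
    then show ?thesis
      using same_derivs2_sym[OF same_derivs2_across_vertex_line[OF sym vertex(3,4,5)]] by simp
  qed
  then show "same_derivs2 (spline_piece S) (spline_piece S') x"
    unfolding k(3) k'(3) u .
qed (rule polynomial_pieces_spline)

end

section \<open>Linearity in the edge coefficients\<close>

text \<open>The value 0 away from the endpoints makes the indicator of an edge/triangle pair
  correspond exactly to the sum of the two indicators in \<open>B1\<close>.\<close>

definition edge_coeffs :: "(pt set \<Rightarrow> pt set \<Rightarrow> real) \<Rightarrow> ecoeffs" where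
  "edge_coeffs g = (\<lambda>(v, e, \<tau>). if v \<in> vertices e then g e \<tau> else 0)"

definition edge_spline :: "ps_config \<Rightarrow> (pt set \<Rightarrow> pt set \<Rightarrow> real) \<Rightarrow> pt \<Rightarrow> real" where
  "edge_spline D g = ps_spline D (\<lambda>_ _. 0) (edge_coeffs g)"

text \<open>The cell chosen for \<open>x\<close> does not depend on the coefficients, so linearity
  of the ordinates carries over pointwise.\<close>

lemma ps_spline_linear:
  "ps_spline D (\<lambda>_ _. 0) (\<lambda>\<xi>. a * f \<xi> + b * h \<xi>) x =
   a * ps_spline D (\<lambda>_ _. 0) f x + b * ps_spline D (\<lambda>_ _. 0) h x"
proof -
  let ?c = "\<lambda>\<xi>. a * f \<xi> + b * h \<xi>" and ?z = "\<lambda>_ _. 0::real"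
  have v: "b_vvv D ?z v = 0" "b_vve D ?z v e = 0" "b_vvt D ?z v t = 0" for v e t
    by (simp_all add: b_vvv_def b_vve_def b_vvt_def vertex_affine_def)
  have vet: "b_vet D ?z ?c v e t = a * b_vet D ?z f v e t + b * b_vet D ?z h v e t" for v e t
    by (simp add: b_vet_def v sum.distrib sum_distrib_left algebra_simps)
  have vee: "b_vee D ?z ?c v e t = a * b_vee D ?z f v e t + b * b_vee D ?z h v e t" for v e t
    by (simp add: b_vee_def v vet Let_def sum.distrib sum_distrib_left algebra_simps)
  have vtt: "b_vtt D ?z ?c v t = a * b_vtt D ?z f v t + b * b_vtt D ?z h v t" for v t
    by (simp add: b_vtt_def v sum.distrib sum_distrib_left algebra_simps)
  have eee: "b_eee D ?z ?c e t = a * b_eee D ?z f e t + b * b_eee D ?z h e t" for e t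
    by (simp add: b_eee_def vee sum.distrib sum_distrib_left algebra_simps)
  have eet: "b_eet D ?z ?c e t = a * b_eet D ?z f e t + b * b_eet D ?z h e t" for e t
    by (simp add: b_eet_def vet sum.distrib sum_distrib_left algebra_simps)
  have ett: "b_ett D ?z ?c e t = a * b_ett D ?z f e t + b * b_ett D ?z h e t" for e t
    by (simp add: b_ett_def vtt sum.distrib sum_distrib_left algebra_simps)
  have ttt: "b_ttt D ?z ?c t = a * b_ttt D ?z f t + b * b_ttt D ?z h t" for t
    by (simp add: b_ttt_def vtt sum.distrib sum_distrib_left algebra_simps)
  have "ps_piece D ?z ?c k x = a * ps_piece D ?z f k x + b * ps_piece D ?z h k x" for k
    by (cases k) (simp add: ps_piece_def Let_def v vet vee vtt eee eet ett ttt algebra_simps)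
  then show ?thesis by (simp add: ps_spline_def)
qed

lemma edge_spline_linear:
  "edge_spline D (\<lambda>e \<tau>. a * f e \<tau> + b * h e \<tau>) x = a * edge_spline D f x + b * edge_spline D h x"
proof -
  have "edge_coeffs (\<lambda>e \<tau>. a * f e \<tau> + b * h e \<tau>) = (\<lambda>\<xi>. a * edge_coeffs f \<xi> + b * edge_coeffs h \<xi>)"
    by (auto simp: edge_coeffs_def)
  then show ?thesis unfolding edge_spline_def by (simp add: ps_spline_linear)
qed

lemma edge_spline_sum:
  assumes "finite F"
  shows "edge_spline D (\<lambda>e \<tau>. \<Sum>i\<in>F. f i e \<tau>) x = (\<Sum>i\<in>F. edge_spline D (f i) x)"
  using assms
proof induction
  case empty
  then show ?case using edge_spline_linear[of D 0 "\<lambda>_ _. 0" 0 "\<lambda>_ _. 0" x] by simp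
next
  case (insert i F)
  then show ?case
    using edge_spline_linear[of D 1 "f i" 1 "\<lambda>e \<tau>. \<Sum>i\<in>F. f i e \<tau>" x] by simp
qed

context ps_mesh
begin

lemma B1_edge_spline:
  assumes "t \<in> triangles D" "e edge_of t"
  shows "B1 D (e, \<tau>) x = edge_spline D (\<lambda>e' \<tau>'. if e' = e \<and> \<tau>' = \<tau> then 1 else 0) x"
proof -
  obtain p q r where c: "labelled p q r e t" using edge_labelled[OF assms] .
  note d = labelledD[OF c]
  have "B1 D (e, \<tau>) x = 1 * B0 D (p, e, \<tau>) x + 1 * B0 D (q, e, \<tau>) x"
    using d(5) by (simp add: B1_def d(9))
  also have "\<dots> = ps_spline D (\<lambda>_ _. 0)
     (\<lambda>\<xi>. 1 * (if \<xi> = (p, e, \<tau>) then 1 else 0) + 1 * (if \<xi> = (q, e, \<tau>) then 1 else 0)) x"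
    unfolding B0_def by (rule ps_spline_linear[symmetric])
  also have "(\<lambda>\<xi>. 1 * (if \<xi> = (p, e, \<tau>) then 1 else 0) + 1 * (if \<xi> = (q, e, \<tau>) then 1 else 0)) =
     edge_coeffs (\<lambda>e' \<tau>'. if e' = e \<and> \<tau>' = \<tau> then 1 else 0)"
    using d(5) by (auto simp: edge_coeffs_def d(9))
  finally show ?thesis by (simp add: edge_spline_def)
qed

section \<open>Balance of the twice reduced functions\<close>

lemma B2_triangle:
  assumes "t0 \<in> sym_triangles D"
  obtains g where "B2 D ({}, t0) = edge_spline D g" "balanced g"
proof -
  let ?o = "other_triangle (triangles D)"
  define F where "F = {e. e edge_of t0}"
  have t0: "t0 \<in> triangles D" using assms by (simp add: sym_triangles_def)
  obtain p q r where c: "labelled p q r (closed_segment p q) t0" using triangle_labelled[OF t0] .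
  have "F = {closed_segment p q, closed_segment q r, closed_segment r p}"
    unfolding F_def using edge_of_triangle[OF labelledD(2)[OF c]] labelledD(3)[OF c] by auto
  then have fin: "finite F" by simp
  define \<delta> :: "pt set \<Rightarrow> pt set \<Rightarrow> pt set \<Rightarrow> pt set \<Rightarrow> real"
    where "\<delta> = (\<lambda>e \<tau> e' \<tau>'. if e' = e \<and> \<tau>' = \<tau> then 1 else 0)"
  define f where "f i e \<tau> = 2/3 * \<delta> i t0 e \<tau> + 1/3 * \<delta> i (?o i t0) e \<tau>" for i e \<tau>
  define g where "g e \<tau> = (\<Sum>i\<in>F. f i e \<tau>)" for e \<tau>
  have g: "g e \<tau> = (if e edge_of t0 then (if \<tau> = t0 then 2/3 else 0) + (if \<tau> = ?o e t0 then 1/3 else 0) else 0)" for e \<tau>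
  proof -
    have "g e \<tau> = (\<Sum>i\<in>F. if i = e then (if \<tau> = t0 then 2/3 else 0) + (if \<tau> = ?o e t0 then 1/3 else 0) else 0)"
      unfolding g_def f_def \<delta>_def by (rule sum.cong) auto
    then show ?thesis using fin by (simp add: F_def)
  qed
  have "B2 D ({}, t0) x = edge_spline D g x" for x
  proof -
    have "B2 D ({}, t0) x = (\<Sum>e\<in>F. 2/3 * B1 D (e, t0) x + 1/3 * B1 D (e, ?o e t0) x)"
      by (simp add: B2_def F_def)
    also have "\<dots> = (\<Sum>e\<in>F. edge_spline D (f e) x)"
    proof (rule sum.cong[OF refl])
      fix e assume "e \<in> F"
      then have "e edge_of t0" by (simp add: F_def)
      note B1_edge_spline[OF t0 this]
      then show "2/3 * B1 D (e, t0) x + 1/3 * B1 D (e, ?o e t0) x = edge_spline D (f e) x"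
        unfolding f_def[abs_def] edge_spline_linear \<delta>_def by simp
    qed
    also have "\<dots> = edge_spline D g x"
      unfolding g_def[abs_def] by (rule edge_spline_sum[OF fin, symmetric])
    finally show ?thesis .
  qed
  moreover have "balanced g"
    unfolding balanced_def
  proof (intro ballI exI allI impI)
    fix t e assume t: "t \<in> sym_triangles D" and e: "e edge_of t"
    note o = sym_triangle_other[OF t e]
    \<comment> \<open>For \<open>t0\<close> itself 2 * 2/3 - 1/3 = 1. A symmetric neighbour of
      \<open>t0\<close> sees the weights exchanged, 2 * 1/3 - 2/3 = 0, at the shared edge and zeros
      at edges outside \<open>t0\<close>.\<close>
    show "2 * g e t - g e (?o e t) = (if t = t0 then 1 else 0)"
    proof (cases "t = t0")
      case True
      then show ?thesis using e o unfolding g by simp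
    next
      case False
      show ?thesis
      proof (cases "e edge_of t0")
        case True
        have "?o e t = t0" using other_triangle_eq(1)[OF o(1) t0 e True False] .
        moreover have "?o e t0 = t" using other_triangle_eq(1)[OF t0 o(1) True e] False by blast
        ultimately show ?thesis using True False unfolding g by simp
      next
        case no: False
        then show ?thesis using False unfolding g by simp
      qed
    qed
  qed
  ultimately show thesis using that by blast
qed

lemma B2_edge:
  assumes \<eta>: "(e0, \<tau>0) \<in> Xi1 D" "\<tau>0 \<notin> sym_triangles D"
  obtains g where "B2 D (e0, \<tau>0) = edge_spline D g" "balanced g"
proof -
  let ?o = "other_triangle (triangles D)"
  obtain t1 where t1: "t1 \<in> triangles D" "e0 edge_of t1"
    using \<eta>(1) by (auto simp: Xi1_def edge_set_def)
  have ne: "e0 \<noteq> {}" using t1(2) by (auto simp: edge_of_def)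
  define \<delta> :: "pt set \<Rightarrow> pt set \<Rightarrow> pt set \<Rightarrow> pt set \<Rightarrow> real"
    where "\<delta> = (\<lambda>e \<tau> e' \<tau>'. if e' = e \<and> \<tau>' = \<tau> then 1 else 0)"
  note B1 = B1_edge_spline[OF t1]
  show thesis
  proof (cases "\<exists>t\<in>sym_triangles D. e0 edge_of t \<and> t \<noteq> \<tau>0")
    case True
    then obtain s where s: "s \<in> sym_triangles D" "e0 edge_of s" "s \<noteq> \<tau>0" by blast
    note os = sym_triangle_other[OF s(1,2)]
    \<comment> \<open>An edge of a symmetric triangle is not a boundary edge, which excludes the
      index \<open>{}\<close>.\<close>
    have \<tau>0: "\<tau>0 \<in> triangles D" "e0 edge_of \<tau>0" using \<eta>(1) os(5) by (auto simp: Xi1_def)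
    have o: "?o e0 \<tau>0 = s" using other_triangle_eq(1)[OF \<tau>0(1) os(1) \<tau>0(2) s(2)] s(3) by blast
    define g where "g e \<tau> = 2/3 * \<delta> e0 \<tau>0 e \<tau> + 1/3 * \<delta> e0 s e \<tau>" for e \<tau>
    have "B2 D (e0, \<tau>0) x = edge_spline D g x" for x
      using True ne unfolding g_def[abs_def] edge_spline_linear \<delta>_def
      by (simp add: B2_def o B1)
    moreover have "balanced g"
      unfolding balanced_def
    proof (intro ballI exI allI impI)
      fix t e assume t: "t \<in> sym_triangles D" and e: "e edge_of t"
      note o = sym_triangle_other[OF t e]
      have ne: "t \<noteq> \<tau>0" using t \<eta>(2) by blast
      \<comment> \<open>Only \<open>s\<close> can be a symmetric triangle at \<open>e0\<close>,
        since the other side is \<open>\<tau>0\<close>; there 2 * 1/3 - 2/3 = 0.\<close>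
      show "2 * g e t - g e (?o e t) = 0"
      proof (cases "e = e0")
        case True
        have "t = s" using at_most_two_triangles[OF \<tau>0(1) o(1) os(1), of e0] True e \<tau>0(2) s(2,3) ne by blast
        moreover have "?o e t = \<tau>0" using other_triangle_eq(1)[OF o(1) \<tau>0(1) e] True \<tau>0(2) ne by blast
        ultimately show ?thesis using True s(3) unfolding g_def \<delta>_def by simp
      next
        case False
        then show ?thesis unfolding g_def \<delta>_def by simp
      qed
    qed
    ultimately show thesis using that by blast
  next
    case False
    have "B2 D (e0, \<tau>0) x = edge_spline D (\<delta> e0 \<tau>0) x" for x
      using ne unfolding B2_def prod.case if_not_P[OF False] by (simp add: B1 \<delta>_def)
    moreover have "balanced (\<delta> e0 \<tau>0)"
      unfolding balanced_def
    proof (intro ballI exI allI impI)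
      fix t e assume t: "t \<in> sym_triangles D" and e: "e edge_of t"
      \<comment> \<open>No symmetric triangle is attached to \<open>e0\<close> in this case, so its
        coefficient is invisible to the balance condition.\<close>
      have "e \<noteq> e0" using False t e \<eta>(2) by blast
      then show "2 * \<delta> e0 \<tau>0 e t - \<delta> e0 \<tau>0 e (?o e t) = 0" by (simp add: \<delta>_def)
    qed
    ultimately show thesis using that by blast
  qed
qed

lemma B2_smooth:
  assumes "\<eta> \<in> Xi2 D"
  shows "(\<forall>t\<in>triangles D. C2_at (ps_cells D) (B2 D \<eta>) (tsplit D t)) \<and>
         (\<forall>t\<in>triangles D. \<forall>e. e edge_of t \<longrightarrow>
            C2_across (ps_cells D) (B2 D \<eta>) (closed_segment (esplit D e) (tsplit D t))) \<and>
         (\<forall>t\<in>sym_triangles D. \<forall>x\<in>interior t. C2_at (ps_cells D) (B2 D \<eta>) x)"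
proof -
  obtain g where B2: "B2 D \<eta> = edge_spline D g" and g: "balanced g"
    using assms B2_triangle B2_edge unfolding Xi2_def by blast
  interpret ps_reduced D "edge_coeffs g" g
  proof
    show "edge_coeffs g (v, e, \<tau>) = g e \<tau>" if "v \<in> vertices e" for v e \<tau>
      using that by (simp add: edge_coeffs_def)
    show "balanced g" by (rule g)
  qed
  show ?thesis
    unfolding B2 edge_spline_def
    using C2_at_split_point C2_across_edge_line C2_at_sym_interior by blast
qed

end

theorem theorem7:
  fixes \<Omega> :: "pt set" and \<T> :: "pt set set" and l :: nat and D :: ps_config
    and \<eta> :: "pt set \<times> pt set"
  assumes "polygonal_domain \<Omega>" and "bounded \<Omega>"
    and "triangulation_of \<T> \<Omega>"
    and "l \<ge> 1"
    and "triangles D = uniform_refinement l \<T>"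
    and "ps_split_points D"
    and "ps_vertex_triangles D"
    and "\<eta> \<in> Xi2 D"
  shows "(\<forall>t\<in>triangles D. C2_at (ps_cells D) (B2 D \<eta>) (tsplit D t)) \<and>
         (\<forall>t\<in>triangles D. \<forall>e. e edge_of t \<longrightarrow>
            C2_across (ps_cells D) (B2 D \<eta>) (closed_segment (esplit D e) (tsplit D t))) \<and>
         (\<forall>t\<in>sym_triangles D. \<forall>x\<in>interior t. C2_at (ps_cells D) (B2 D \<eta>) x)"
proof -
  have T: "triangulation \<T>" "\<And>T. T \<in> \<T> \<Longrightarrow> 2 simplex T"
    using assms(3) by (auto simp: triangulation_of_def)
  interpret ps_mesh D
    using uniform_refinement_conforming[OF T assms(4)] assms(5,6) by unfold_locales auto
  show ?thesis by (rule B2_smooth[OF assms(8)])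
qed

end
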